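(* Let $\Gamma$ be a countable group and let $H_1,H_2$ be independent co-amenable invariant random subgroups of $\Gamma$. Then the intersection $H_1\cap H_2$ is co-amenable (that is, $H_1\cap H_2$ is almost surely a co-amenable subgroup of $\Gamma$).
   Context: For a finite symmetric subset $S\subset\Gamma$ and a subgroup $H\subset \Gamma$, the co-spectral radius of $H$ (with respect to $S$) is the operator norm $\rho(\Gamma/H):=\|M\|$ of the operator $M\colon L^2(\Gamma/H)\to L^2(\Gamma/H)$ ($\Gamma/H$ carries counting measure) given by \[ M\phi(\gamma H)=\frac{1}{|S|}\sum_{s\in S}\phi(s\gamma H).\] A subgroup $H$ is called co-amenable in $\Gamma$ if its co-spectral radius equals $1$ for every choice of the finite symmetric subset $S$. Let $\mathrm{Sub}_\Gamma$ be the space of subgroups of $\Gamma$ with the topology induced from $\{0,1\}^\Gamma$. An invariant random subgroup (IRS) of $\Gamma$ is a random subgroup whose distribution is a Borel probability measure on $\mathrm{Sub}_\Gamma$ invariant under conjugation by $\Gamma$. An IRS is called co-amenable if it is almost surely a co-amenable subgroup. Independence of $H_1,H_2$ means that they are independent as $\mathrm{Sub}_\Gamma$-valued random variables. *)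

theory Defs
  imports "HOL-Probability.Probability" "HOL-Algebra.Left_Coset"
begin

section \<open>Co-spectral radius and co-amenability\<close>

text \<open>Elements of \<open>L\<^sup>2(X)\<close>, for the counting measure on \<open>X\<close>, are represented by functions on the
  whole type; both the membership and the norm depend only on the values on \<open>X\<close>.\<close>

definition l2_space :: "'x set \<Rightarrow> ('x \<Rightarrow> complex) set" where
  "l2_space X = {\<phi>. integrable (count_space X) (\<lambda>x. (cmod (\<phi> x))\<^sup>2)}"

definition l2_norm :: "'x set \<Rightarrow> ('x \<Rightarrow> complex) \<Rightarrow> real" where
  "l2_norm X \<phi> = sqrt (LINT x|count_space X. (cmod (\<phi> x))\<^sup>2)"

text \<open>The same formula as the library's \<open>onorm\<close>, which needs a type-class normed space; the
  quotient is \<open>0\<close> when \<open>\<phi>\<close> vanishes on \<open>X\<close>.\<close>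

definition l2_onorm :: "'x set \<Rightarrow> (('x \<Rightarrow> complex) \<Rightarrow> ('x \<Rightarrow> complex)) \<Rightarrow> real" where
  "l2_onorm X T = (SUP \<phi>\<in>l2_space X. l2_norm X (T \<phi>) / l2_norm X \<phi>)"

text \<open>For a left coset \<open>C = \<gamma>H\<close>, the coset \<open>s\<gamma>H\<close> is the translate of \<open>C\<close> by \<open>s\<close>.\<close>

definition averaging_op ::
  "('a, 'm) monoid_scheme \<Rightarrow> 'a set \<Rightarrow> ('a set \<Rightarrow> complex) \<Rightarrow> 'a set \<Rightarrow> complex" where
  "averaging_op G S \<phi> C = (1 / of_nat (card S)) * (\<Sum>s\<in>S. \<phi> (s <#\<^bsub>G\<^esub> C))"

definition cospectral_radius :: "('a, 'm) monoid_scheme \<Rightarrow> 'a set \<Rightarrow> 'a set \<Rightarrow> real" where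
  "cospectral_radius G S H = l2_onorm (lcosets\<^bsub>G\<^esub> H) (averaging_op G S)"

text \<open>Nonemptiness of \<open>S\<close> is implicit in the normalisation by \<open>1 / card S\<close>.\<close>

definition finite_symmetric_subset :: "('a, 'm) monoid_scheme \<Rightarrow> 'a set \<Rightarrow> bool" where
  "finite_symmetric_subset G S \<longleftrightarrow>
     finite S \<and> S \<noteq> {} \<and> S \<subseteq> carrier G \<and> (\<forall>s\<in>S. inv\<^bsub>G\<^esub> s \<in> S)"

definition coamenable :: "('a, 'm) monoid_scheme \<Rightarrow> 'a set \<Rightarrow> bool" where
  "coamenable G H \<longleftrightarrow> subgroup H G \<and>
     (\<forall>S. finite_symmetric_subset G S \<longrightarrow> cospectral_radius G S H = 1)"

section \<open>Invariant random subgroups\<close>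

text \<open>The space of subgroups, with the topology induced from the product space \<open>{0,1}\<^sup>G\<close> by
  sending a subgroup to its indicator function.\<close>

definition Sub_topology :: "('a, 'm) monoid_scheme \<Rightarrow> 'a set topology" where
  "Sub_topology G = pullback_topology {H. subgroup H G} (\<lambda>H. \<lambda>g\<in>carrier G. g \<in> H)
     (product_topology (\<lambda>_. discrete_topology (UNIV :: bool set)) (carrier G))"

lemma topspace_Sub_topology: "topspace (Sub_topology G) = {H. subgroup H G}"
  by (auto simp: Sub_topology_def topspace_pullback_topology)

definition Sub_borel :: "('a, 'm) monoid_scheme \<Rightarrow> 'a set measure" where
  "Sub_borel G = sigma (topspace (Sub_topology G)) {U. openin (Sub_topology G) U}"

definition conj_subgroup :: "('a, 'm) monoid_scheme \<Rightarrow> 'a \<Rightarrow> 'a set \<Rightarrow> 'a set" where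
  "conj_subgroup G g H = (g <#\<^bsub>G\<^esub> H) #>\<^bsub>G\<^esub> (inv\<^bsub>G\<^esub> g)"

text \<open>A random subgroup on a probability space \<open>M\<close> whose distribution is invariant under
  conjugation.\<close>

definition invariant_random_subgroup ::
  "('a, 'm) monoid_scheme \<Rightarrow> 'w measure \<Rightarrow> ('w \<Rightarrow> 'a set) \<Rightarrow> bool" where
  "invariant_random_subgroup G M H \<longleftrightarrow>
     prob_space M \<and> H \<in> measurable M (Sub_borel G) \<and>
     (\<forall>g\<in>carrier G. distr (distr M (Sub_borel G) H) (Sub_borel G) (conj_subgroup G g)
                     = distr M (Sub_borel G) H)"

definition coamenable_irs ::
  "('a, 'm) monoid_scheme \<Rightarrow> 'w measure \<Rightarrow> ('w \<Rightarrow> 'a set) \<Rightarrow> bool" where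
  "coamenable_irs G M H \<longleftrightarrow>
     invariant_random_subgroup G M H \<and> (AE \<omega> in M. coamenable G (H \<omega>))"

end

theory Submission
  imports Defs
begin

text \<open>Co-amenability is turned into a statement about finite data. For a group acting on a set, a
  finite set \<open>S\<close> of group elements and \<open>\<delta> > 0\<close>, call a finitely supported \<open>f \<ge> 0\<close> a Reiter function
  if \<open>\<Sum>s\<in>S. \<Sum>x. max 0 (f x - f (s x)) < \<delta> * (\<Sum>x. f x)\<close>. A subgroup \<open>H\<close> is co-amenable if and only if
  \<open>G/H\<close> carries a Reiter function for all \<open>S\<close> and \<open>\<delta>\<close>: a function that nearly attains the norm of an
  averaging operator is almost invariant, and one takes the square of its modulus; conversely, the
  square root of a Reiter function is nearly fixed by the averaging operator
  (\<open>reiter_if_coamenable\<close>, \<open>coamenable_if_reiter\<close>).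

  The heart is the case where \<open>H\<close> is a fixed co-amenable subgroup and \<open>K\<close> is a co-amenable invariant
  random subgroup (\<open>AE_reiter_Int\<close>). Let \<open>u\<close> and \<open>v\<close> be Reiter functions on \<open>G/H\<close> and \<open>G/K\<close>. Then
  \<open>u(C) * v(D)\<close> is a Reiter function on \<open>G/H \<times> G/K\<close> for the diagonal action, and the orbits of that
  action are the coset spaces of the intersections of conjugates of \<open>H\<close> and \<open>K\<close>. Hence some of
  these intersections have Reiter functions; the issue is to reach \<open>H \<inter> K\<close> itself for almost every
  \<open>K\<close>. Fix \<open>S\<close> and \<open>\<delta>\<close>, call an orbit bad if it has no Reiter function for them, and suppose that the
  orbit of \<open>(H, K)\<close> is bad with probability \<open>p > 0\<close>. Three facts contradict each other.

  \<^item> Orbits are invariant, so the loss of the product function is the sum of its losses on the orbits.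
    As a bad orbit loses at least \<open>\<delta>\<close> times its mass, the bad orbits together have small mass.

  \<^item> By conjugation invariance every pair \<open>(C, K)\<close>, for fixed \<open>C\<close>, lies in a bad orbit with probability at
    least \<open>p\<close>. So in the fibre over the base point \<open>K\<close> of \<open>G/K\<close> the expected proportion of bad \<open>u\<close>-mass is
    at least \<open>p\<close>.

  \<^item> Badness is invariant, so translation by \<open>g\<close> identifies the bad part of the fibre over \<open>K\<close>
    with the bad part of the fibre over \<open>gK\<close>. If \<open>u\<close> is almost invariant under \<open>g\<close>, the bad mass of the
    two fibres is nearly the same.

  The order of choices makes this work. First fix a finite set \<open>T\<close> such that with probability more
  than \<open>1 - p/2\<close> there is a Reiter function \<open>v\<close> supported on the cosets \<open>gK\<close> with \<open>g \<in> T\<close>; then choose \<open>u\<close>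
  almost invariant under \<open>T\<close> as well as under \<open>S\<close>. For some \<open>K\<close> both \<open>v\<close> exists and the fibre over \<open>K\<close>
  has a proportion of bad mass of at least \<open>p/2\<close>; then all fibres that meet the support of \<open>v\<close> have nearly
  that proportion, and the bad mass is not small (\<open>non_reiter_mass_bound\<close>).

  For two independent random subgroups the result follows from Fubini's theorem. The measurability
  that this needs comes from finiteness: whether there is a Reiter function on the cosets of
  finitely many elements depends only on the membership of finitely many elements in the subgroup
  (\<open>reiter_on_cosets_cong\<close>, \<open>sets_reiter\<close>).\<close>

(* The proper inclusion of multisets has the same symbol as the left translate. *)
no_notation subset_mset (infix \<open><#\<close> 50)

section \<open>Almost invariant functions of finite support\<close>

text \<open>Only the decrease of \<open>f\<close> is counted. A sum over the support is then enough, and when \<open>act s\<close> is a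
  bijection this is half of the usual \<open>\<ell>\<^sup>1\<close>-distance between \<open>f\<close> and its translate.\<close>

definition loss :: "('g \<Rightarrow> 'x \<Rightarrow> 'x) \<Rightarrow> 'g set \<Rightarrow> 'x set \<Rightarrow> ('x \<Rightarrow> real) \<Rightarrow> real" where
  "loss act S T f = (\<Sum>s\<in>S. \<Sum>x\<in>T. max 0 (f x - f (act s x)))"

definition reiter_on :: "('g \<Rightarrow> 'x \<Rightarrow> 'x) \<Rightarrow> 'g set \<Rightarrow> real \<Rightarrow> 'x set \<Rightarrow> bool" where
  "reiter_on act S \<delta> T \<longleftrightarrow> finite T \<and>
     (\<exists>f. (\<forall>x. 0 \<le> f x) \<and> (\<forall>x. x \<notin> T \<longrightarrow> f x = 0) \<and> loss act S T f < \<delta> * sum f T)"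

lemma reiter_onI:
  assumes "finite T" "\<And>x. 0 \<le> f x" "\<And>x. x \<notin> T \<Longrightarrow> f x = 0"
    and "loss act S T f < \<delta> * sum f T"
  shows "reiter_on act S \<delta> T"
  using assms unfolding reiter_on_def by (intro conjI exI[of _ f]) auto

lemma loss_nonneg: "0 \<le> loss act S T f"
  by (auto simp: loss_def intro!: sum_nonneg)

lemma loss_mono_elements:
  assumes "finite S" "S' \<subseteq> S"
  shows "loss act S' T f \<le> loss act S T f"
  unfolding loss_def by (rule sum_mono2) (use assms in \<open>auto intro!: sum_nonneg\<close>)

lemma reiter_on_superset:
  assumes "reiter_on act S \<delta> T" "T \<subseteq> T'" "finite T'"
  shows "reiter_on act S \<delta> T'"
proof -
  from assms(1) obtain f where f: "\<And>x. 0 \<le> f x" "\<And>x. x \<notin> T \<Longrightarrow> f x = 0"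
    "loss act S T f < \<delta> * sum f T"
    unfolding reiter_on_def by auto
  have "loss act S T' f = loss act S T f"
    unfolding loss_def
    by (rule sum.cong[OF refl], rule sum.mono_neutral_right) (use assms f in auto)
  moreover have "sum f T' = sum f T"
    by (rule sum.mono_neutral_right) (use assms f in auto)
  ultimately show ?thesis
    using f assms by (intro reiter_onI[of _ f]) auto
qed

text \<open>Off \<open>T\<close> the function vanishes, so the action matters only where it maps points of \<open>T\<close> to \<open>T\<close>;
  equivariance of \<open>\<theta>\<close> is therefore asked only there. This applies to injective equivariant maps of
  actions and also to maps that are defined on a finite piece of an action.\<close>

lemma reiter_on_image:
  assumes "reiter_on act S \<delta> T" and inj: "inj_on \<theta> T"
    and equi: "\<And>s x. s \<in> S \<Longrightarrow> x \<in> T \<Longrightarrow> act s x \<in> T \<Longrightarrow> act' s (\<theta> x) = \<theta> (act s x)"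
    and stays: "\<And>s x. s \<in> S \<Longrightarrow> x \<in> T \<Longrightarrow> act' s (\<theta> x) \<in> \<theta> ` T \<Longrightarrow> act s x \<in> T"
  shows "reiter_on act' S \<delta> (\<theta> ` T)"
proof -
  from assms(1) obtain f where T: "finite T"
    and f: "\<And>x. 0 \<le> f x" "\<And>x. x \<notin> T \<Longrightarrow> f x = 0" "loss act S T f < \<delta> * sum f T"
    unfolding reiter_on_def by auto
  define f' where "f' y = (if y \<in> \<theta> ` T then f (the_inv_into T \<theta> y) else 0)" for y
  have f'_\<theta>: "f' (\<theta> x) = f x" if "x \<in> T" for x
    using that inj by (auto simp: f'_def the_inv_into_f_f)
  have f'_act: "f' (act' s (\<theta> x)) = f (act s x)" if "s \<in> S" "x \<in> T" for s x
  proof (cases "act s x \<in> T")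
    case True
    then show ?thesis using that equi f'_\<theta> by simp
  next
    case False
    then have "act' s (\<theta> x) \<notin> \<theta> ` T" using stays that by blast
    then have "f' (act' s (\<theta> x)) = 0" unfolding f'_def by (rule if_not_P)
    then show ?thesis using f False by simp
  qed
  have "loss act' S (\<theta> ` T) f' = loss act S T f"
    unfolding loss_def using inj by (simp add: sum.reindex f'_\<theta> f'_act)
  moreover have "sum f' (\<theta> ` T) = sum f T"
    using inj by (simp add: sum.reindex f'_\<theta>)
  moreover have "0 \<le> f' y" for y
    using f(1) by (simp add: f'_def)
  moreover have "f' y = 0" if "y \<notin> \<theta> ` T" for y
    using that unfolding f'_def by (rule if_not_P)
  ultimately show ?thesis
    using f T by (intro reiter_onI[of _ f']) auto
qed

text \<open>The classes of \<open>c\<close> play the role of orbits. Since the action preserves them, the loss of \<open>f\<close> is the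
  sum of the losses of the restrictions of \<open>f\<close> to the classes, and each restriction to a class without
  Reiter function loses at least \<open>\<delta>\<close> times its mass.\<close>

lemma mass_of_non_reiter_classes_le_loss:
  assumes T: "finite T" and f: "\<And>x. 0 \<le> f x" "\<And>x. x \<notin> T \<Longrightarrow> f x = 0"
    and c: "\<And>s x. s \<in> S \<Longrightarrow> x \<in> T \<Longrightarrow> act s x \<in> T \<Longrightarrow> c (act s x) = c x"
  shows "\<delta> * (\<Sum>x | x \<in> T \<and> \<not> reiter_on act S \<delta> {y\<in>T. c y = c x}. f x) \<le> loss act S T f"
proof -
  let ?bad = "\<lambda>k. \<not> reiter_on act S \<delta> {y\<in>T. c y = k}"
  have "\<delta> * (\<Sum>x | x \<in> T \<and> ?bad (c x). f x)
      = (\<Sum>k\<in>c ` T. \<Sum>x | x \<in> T \<and> c x = k. if ?bad (c x) then \<delta> * f x else 0)"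
    by (subst sum.group) (use T in \<open>auto simp: sum_distrib_left sum.inter_filter[symmetric]\<close>)
  also have "\<dots> \<le> (\<Sum>k\<in>c ` T. \<Sum>x | x \<in> T \<and> c x = k. \<Sum>s\<in>S. max 0 (f x - f (act s x)))"
  proof (rule sum_mono)
    fix k
    let ?T = "{x\<in>T. c x = k}"
    show "(\<Sum>x\<in>?T. if ?bad (c x) then \<delta> * f x else 0)
        \<le> (\<Sum>x\<in>?T. \<Sum>s\<in>S. max 0 (f x - f (act s x)))"
    proof (cases "?bad k")
      case True
      define g where "g x = (if x \<in> ?T then f x else 0)" for x
      have "\<not> loss act S ?T g < \<delta> * sum g ?T"
      proof
        assume "loss act S ?T g < \<delta> * sum g ?T"
        then have "reiter_on act S \<delta> ?T"
          using T f by (intro reiter_onI[of _ g]) (auto simp: g_def)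
        then show False using True by contradiction
      qed
      moreover have "loss act S ?T g \<le> (\<Sum>s\<in>S. \<Sum>x\<in>?T. max 0 (f x - f (act s x)))"
        unfolding loss_def
      proof (intro sum_mono)
        fix s x assume "s \<in> S" "x \<in> ?T"
        then have "g (act s x) = f (act s x)"
          using c f by (auto simp: g_def)
        then show "max 0 (g x - g (act s x)) \<le> max 0 (f x - f (act s x))"
          using \<open>x \<in> ?T\<close> by (simp add: g_def)
      qed
      moreover have "(\<Sum>x\<in>?T. if ?bad (c x) then \<delta> * f x else 0) = \<delta> * sum g ?T"
        unfolding sum_distrib_left using True by (intro sum.cong) (auto simp: g_def)
      ultimately show ?thesis
        using sum.swap[of "\<lambda>s x. max 0 (f x - f (act s x))" ?T S] by linarith
    next
      case False
      then have "(\<Sum>x\<in>?T. if ?bad (c x) then \<delta> * f x else 0) = 0"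
        by (intro sum.neutral) auto
      then show ?thesis by (auto intro!: sum_nonneg)
    qed
  qed
  also have "\<dots> = loss act S T f"
    unfolding loss_def by (subst sum.group) (use T in \<open>auto intro: sum.swap\<close>)
  finally show ?thesis .
qed

text \<open>The pointwise reason is \<open>u v - u' v' = (u - u') v' + u (v - v')\<close>; a translate of \<open>v\<close> has at most the
  mass of \<open>v\<close>.\<close>

lemma loss_product:
  assumes T: "finite T" "finite T'"
    and u: "\<And>x. 0 \<le> u x" and v: "\<And>y. 0 \<le> v y" "\<And>y. y \<notin> T' \<Longrightarrow> v y = 0"
    and inj: "\<And>s. s \<in> S \<Longrightarrow> inj_on (act' s) T'"
  shows "loss (\<lambda>s p. (act s (fst p), act' s (snd p))) S (T \<times> T') (\<lambda>p. u (fst p) * v (snd p))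
    \<le> loss act S T u * sum v T' + sum u T * loss act' S T' v"
proof -
  have v_shift: "(\<Sum>y\<in>T'. v (act' s y)) \<le> sum v T'" if "s \<in> S" for s
  proof -
    have "(\<Sum>y\<in>T'. v (act' s y)) = sum v (act' s ` T')"
      using inj[OF that] by (simp add: sum.reindex)
    also have "\<dots> = sum v (act' s ` T' \<inter> T')"
      by (rule sum.mono_neutral_right) (use T v in auto)
    also have "\<dots> \<le> sum v T'"
      by (rule sum_mono2) (use T v in auto)
    finally show ?thesis .
  qed
  have pointwise: "max 0 (u x * v y - u (act s x) * v (act' s y))
      \<le> max 0 (u x - u (act s x)) * v (act' s y) + u x * max 0 (v y - v (act' s y))" for s x y
  proof -
    have "u x * v y - u (act s x) * v (act' s y)
        = (u x - u (act s x)) * v (act' s y) + u x * (v y - v (act' s y))"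
      by (simp add: algebra_simps)
    also have "\<dots> \<le> max 0 (u x - u (act s x)) * v (act' s y) + u x * max 0 (v y - v (act' s y))"
      using u v by (intro add_mono mult_right_mono mult_left_mono) auto
    finally show ?thesis using u v by simp
  qed
  have "loss (\<lambda>s p. (act s (fst p), act' s (snd p))) S (T \<times> T') (\<lambda>p. u (fst p) * v (snd p))
     = (\<Sum>s\<in>S. \<Sum>x\<in>T. \<Sum>y\<in>T'. max 0 (u x * v y - u (act s x) * v (act' s y)))"
    unfolding loss_def by (simp add: sum.cartesian_product split_def)
  also have "\<dots> \<le> (\<Sum>s\<in>S. \<Sum>x\<in>T. \<Sum>y\<in>T'.
      max 0 (u x - u (act s x)) * v (act' s y) + u x * max 0 (v y - v (act' s y)))"
    by (intro sum_mono pointwise)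
  also have "\<dots> = (\<Sum>s\<in>S. (\<Sum>x\<in>T. max 0 (u x - u (act s x))) * (\<Sum>y\<in>T'. v (act' s y))
      + sum u T * (\<Sum>y\<in>T'. max 0 (v y - v (act' s y))))"
    by (simp add: sum.distrib sum_product)
  also have "\<dots> \<le> (\<Sum>s\<in>S. (\<Sum>x\<in>T. max 0 (u x - u (act s x))) * sum v T'
      + sum u T * (\<Sum>y\<in>T'. max 0 (v y - v (act' s y))))"
    by (intro sum_mono add_right_mono mult_left_mono v_shift sum_nonneg) auto
  also have "\<dots> = loss act S T u * sum v T' + sum u T * loss act' S T' v"
    unfolding loss_def sum.distrib sum_distrib_right[symmetric] sum_distrib_left[symmetric] ..
  finally show ?thesis .
qed

section \<open>Left cosets and conjugates of subgroups\<close>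

definition reiter :: "('a, 'm) monoid_scheme \<Rightarrow> 'a set \<Rightarrow> real \<Rightarrow> 'a set \<Rightarrow> bool" where
  "reiter G S \<delta> H \<longleftrightarrow> (\<exists>T \<subseteq> lcosets\<^bsub>G\<^esub> H. reiter_on (l_coset G) S \<delta> T)"

lemma reiter_mono:
  assumes "reiter G S \<delta> H" "\<delta> \<le> \<delta>'"
  shows "reiter G S \<delta>' H"
proof -
  obtain T where T: "T \<subseteq> lcosets\<^bsub>G\<^esub> H" "reiter_on (l_coset G) S \<delta> T"
    using assms(1) unfolding reiter_def by blast
  then obtain f where f: "finite T" "\<And>C. 0 \<le> f C" "\<And>C. C \<notin> T \<Longrightarrow> f C = 0"
    "loss (l_coset G) S T f < \<delta> * sum f T"
    unfolding reiter_on_def by blast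
  note f(4)
  also have "\<delta> * sum f T \<le> \<delta>' * sum f T"
    by (intro mult_right_mono assms(2) sum_nonneg f(2))
  finally show ?thesis
    using T(1) reiter_onI[of T f, OF f(1-3)] unfolding reiter_def by blast
qed

context group
begin

lemma inv_mult_cancel:
  assumes "g \<in> carrier G" "x \<in> carrier G"
  shows "g \<otimes> (inv g \<otimes> x) = x" "inv g \<otimes> (g \<otimes> x) = x"
  using assms by (simp_all flip: m_assoc)

lemma l_coset_eq_iff:
  assumes "subgroup H G" "a \<in> carrier G" "b \<in> carrier G"
  shows "a <# H = b <# H \<longleftrightarrow> inv a \<otimes> b \<in> H"
proof
  assume "a <# H = b <# H"
  then have "b \<in> a <# H" using assms lcos_self by simp
  then show "inv a \<otimes> b \<in> H"
    using assms subgroup.lcos_module_imp[OF assms(1) is_group] by blast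
next
  assume "inv a \<otimes> b \<in> H"
  then have "b \<in> a <# H"
    using assms subgroup.lcos_module_rev[OF assms(1) is_group] by blast
  then show "a <# H = b <# H"
    using assms by (intro l_repr_independence)
qed

lemma lcosets_subset_carrier: "subgroup H G \<Longrightarrow> C \<in> lcosets H \<Longrightarrow> C \<subseteq> carrier G"
  using subgroup.lcosets_carrier is_group by blast

lemma l_coset_lcosets:
  assumes "subgroup H G" "g \<in> carrier G" "C \<in> lcosets H"
  shows "g <# C \<in> lcosets H"
  using assms by (auto simp: LCOSETS_def lcos_m_assoc subgroup.subset)

lemma l_coset_cancel:
  assumes "g \<in> carrier G" "C \<subseteq> carrier G"
  shows "inv g <# (g <# C) = C" "g <# (inv g <# C) = C"
  using assms by (auto simp: lcos_m_assoc lcos_mult_one)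

lemma inj_on_l_coset: "g \<in> carrier G \<Longrightarrow> inj_on (l_coset G g) {C. C \<subseteq> carrier G}"
  by (rule inj_on_inverseI[of _ "l_coset G (inv g)"]) (simp add: l_coset_cancel)

lemma bij_betw_l_coset_lcosets:
  assumes "subgroup H G" "g \<in> carrier G"
  shows "bij_betw (l_coset G g) (lcosets H) (lcosets H)"
  by (rule bij_betw_byWitness[of _ "l_coset G (inv g)"])
    (use assms in \<open>auto simp: l_coset_cancel lcosets_subset_carrier l_coset_lcosets\<close>)

lemma l_coset_Int:
  assumes "g \<in> carrier G" "A \<subseteq> carrier G" "B \<subseteq> carrier G"
  shows "g <# (A \<inter> B) = (g <# A) \<inter> (g <# B)"
proof
  show "(g <# A) \<inter> (g <# B) \<subseteq> g <# (A \<inter> B)"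
  proof
    fix x assume "x \<in> (g <# A) \<inter> (g <# B)"
    then obtain a b where ab: "a \<in> A" "b \<in> B" "x = g \<otimes> a" "x = g \<otimes> b"
      by (auto simp: l_coset_def)
    then have "a = b" using assms by (simp add: subset_eq)
    then show "x \<in> g <# (A \<inter> B)" using ab by (auto simp: l_coset_def)
  qed
qed (auto simp: l_coset_def)

text \<open>The incidences \<open>gH = g'H\<close> and \<open>s(gH) = g'H\<close>, for \<open>g, g' \<in> T\<close> and \<open>s \<in> S\<close>, determine the action on the
  cosets of elements of \<open>T\<close> as far as it stays among them, and they amount to the membership of
  certain elements in \<open>H\<close>. If \<open>H'\<close> has the same incidences, then \<open>gH \<mapsto> gH'\<close> carries over Reiter
  functions.\<close>

lemma reiter_on_cosets_cong:
  assumes H: "subgroup H G" "subgroup H' G" and ST: "S \<subseteq> carrier G" "T \<subseteq> carrier G"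
    and eq: "\<And>g g'. g \<in> T \<Longrightarrow> g' \<in> T \<Longrightarrow> inv g \<otimes> g' \<in> H \<longleftrightarrow> inv g \<otimes> g' \<in> H'"
    and eq_act: "\<And>s g g'. s \<in> S \<Longrightarrow> g \<in> T \<Longrightarrow> g' \<in> T \<Longrightarrow>
      inv (s \<otimes> g) \<otimes> g' \<in> H \<longleftrightarrow> inv (s \<otimes> g) \<otimes> g' \<in> H'"
    and R: "reiter_on (l_coset G) S \<delta> ((\<lambda>g. g <# H) ` T)"
  shows "reiter_on (l_coset G) S \<delta> ((\<lambda>g. g <# H') ` T)"
proof -
  define \<theta> where "\<theta> C = (SOME g. g \<in> T \<and> C = g <# H) <# H'" for C
  have \<theta>: "\<theta> (g <# H) = g <# H'" if g: "g \<in> T" for g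
  proof -
    obtain r where r_def: "r = (SOME r. r \<in> T \<and> g <# H = r <# H)" by simp
    have "r \<in> T \<and> g <# H = r <# H"
      unfolding r_def by (rule someI[of _ g]) (use g in auto)
    then have r: "r \<in> T" "inv g \<otimes> r \<in> H" "r \<in> carrier G" "g \<in> carrier G"
      using g ST H by (auto simp: l_coset_eq_iff subset_eq)
    then have "g <# H' = r <# H'"
      using g eq H by (simp add: l_coset_eq_iff)
    then show ?thesis unfolding \<theta>_def r_def ..
  qed
  have act: "s <# (g <# H) = (s \<otimes> g) <# H" "s <# (g <# H') = (s \<otimes> g) <# H'"
    if "s \<in> S" "g \<in> T" for s g
  proof -
    have "s \<in> carrier G" "g \<in> carrier G" using that ST by blast+
    then show "s <# (g <# H) = (s \<otimes> g) <# H" "s <# (g <# H') = (s \<otimes> g) <# H'"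
      using H by (simp_all add: lcos_m_assoc subgroup.subset)
  qed
  have act_eq: "s <# (g <# H) = g' <# H \<longleftrightarrow> s <# (g <# H') = g' <# H'"
    if "s \<in> S" "g \<in> T" "g' \<in> T" for s g g'
  proof -
    have "s \<in> carrier G" "g \<in> carrier G" "g' \<in> carrier G" using that ST by blast+
    then show ?thesis using that H eq_act[OF that] by (simp add: act l_coset_eq_iff)
  qed
  have inj: "inj_on \<theta> ((\<lambda>g. g <# H) ` T)"
  proof (rule inj_onI)
    fix C D assume "C \<in> (\<lambda>g. g <# H) ` T" "D \<in> (\<lambda>g. g <# H) ` T" and CD: "\<theta> C = \<theta> D"
    then obtain g h where gh: "g \<in> T" "C = g <# H" "h \<in> T" "D = h <# H" by blast
    have "g \<in> carrier G" "h \<in> carrier G" using gh ST by blast+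
    then show "C = D" using CD gh H eq[of g h] by (simp add: \<theta> l_coset_eq_iff)
  qed
  have "reiter_on (l_coset G) S \<delta> (\<theta> ` (\<lambda>g. g <# H) ` T)"
  proof (rule reiter_on_image[OF R inj])
    fix s C assume "s \<in> S" "C \<in> (\<lambda>g. g <# H) ` T" "s <# C \<in> (\<lambda>g. g <# H) ` T"
    then obtain g g' where "g \<in> T" "C = g <# H" "g' \<in> T" "s <# C = g' <# H" by auto
    moreover from this have "s <# (g <# H') = g' <# H'"
      using act_eq[of s g g'] \<open>s \<in> S\<close> by blast
    ultimately show "s <# \<theta> C = \<theta> (s <# C)" by (metis \<theta>)
  next
    fix s C assume "s \<in> S" "C \<in> (\<lambda>g. g <# H) ` T" "s <# \<theta> C \<in> \<theta> ` (\<lambda>g. g <# H) ` T"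
    then obtain g g' where "g \<in> T" "C = g <# H" "g' \<in> T" "s <# \<theta> C = \<theta> (g' <# H)" by auto
    moreover from this have "s <# (g <# H') = g' <# H'" by (metis \<theta>)
    ultimately have "s <# C = g' <# H"
      using act_eq[of s g g'] \<open>s \<in> S\<close> by blast
    then show "s <# C \<in> (\<lambda>g. g <# H) ` T" using \<open>g' \<in> T\<close> by blast
  qed
  moreover have "\<theta> ` (\<lambda>g. g <# H) ` T = (\<lambda>g. g <# H') ` T"
    unfolding image_image by (rule image_cong[OF refl \<theta>])
  ultimately show ?thesis by simp
qed

lemma reiter_iff_finite_representatives:
  assumes "subgroup H G"
  shows "reiter G S \<delta> H \<longleftrightarrow>
    (\<exists>T. finite T \<and> T \<subseteq> carrier G \<and> reiter_on (l_coset G) S \<delta> ((\<lambda>g. g <# H) ` T))"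
proof
  assume "reiter G S \<delta> H"
  then obtain R where R: "R \<subseteq> lcosets H" "reiter_on (l_coset G) S \<delta> R"
    by (auto simp: reiter_def)
  have "finite R" using R(2) by (simp add: reiter_on_def)
  moreover have "R \<subseteq> (\<lambda>g. g <# H) ` carrier G"
    using R(1) by (auto simp: LCOSETS_def)
  ultimately obtain T where "T \<subseteq> carrier G" "finite T" "R = (\<lambda>g. g <# H) ` T"
    using finite_subset_image by metis
  then show "\<exists>T. finite T \<and> T \<subseteq> carrier G \<and> reiter_on (l_coset G) S \<delta> ((\<lambda>g. g <# H) ` T)"
    using R by auto
next
  assume "\<exists>T. finite T \<and> T \<subseteq> carrier G \<and> reiter_on (l_coset G) S \<delta> ((\<lambda>g. g <# H) ` T)"
  then obtain T where "T \<subseteq> carrier G" "reiter_on (l_coset G) S \<delta> ((\<lambda>g. g <# H) ` T)"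
    by blast
  moreover from this have "(\<lambda>g. g <# H) ` T \<subseteq> lcosets H" by (auto simp: LCOSETS_def)
  ultimately show "reiter G S \<delta> H" unfolding reiter_def by blast
qed

lemma conj_subgroup_subset:
  "g \<in> carrier G \<Longrightarrow> K \<subseteq> carrier G \<Longrightarrow> conj_subgroup G g K \<subseteq> carrier G"
  by (simp add: conj_subgroup_def l_coset_subset_G r_coset_subset_G)

lemma mem_conj_subgroup_iff:
  assumes "g \<in> carrier G" "h \<in> carrier G" "K \<subseteq> carrier G"
  shows "h \<in> conj_subgroup G g K \<longleftrightarrow> inv g \<otimes> h \<otimes> g \<in> K"
proof -
  have "h = g \<otimes> k \<otimes> inv g \<longleftrightarrow> inv g \<otimes> h \<otimes> g = k" if "k \<in> K" for k
  proof -
    have "k \<in> carrier G" using that assms(3) by (rule subsetD[rotated])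
    then show ?thesis using assms(1,2) by (auto simp: m_assoc inv_mult_cancel)
  qed
  then have "(\<exists>k\<in>K. h = g \<otimes> k \<otimes> inv g) \<longleftrightarrow> (\<exists>k\<in>K. inv g \<otimes> h \<otimes> g = k)" by simp
  then show ?thesis by (simp add: conj_subgroup_def l_coset_def r_coset_def)
qed

lemma subgroup_conj_subgroup:
  assumes g: "g \<in> carrier G" and K: "subgroup K G"
  shows "subgroup (conj_subgroup G g K) G"
proof (rule subgroupI)
  note sub = subgroup.subset[OF K]
  note memb = mem_conj_subgroup_iff[OF g _ sub]
  show "conj_subgroup G g K \<subseteq> carrier G" by (rule conj_subgroup_subset[OF g sub])
  then have carr: "x \<in> carrier G" if "x \<in> conj_subgroup G g K" for x
    using that by (rule subsetD)
  have "\<one> \<in> conj_subgroup G g K"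
    using g subgroup.one_closed[OF K] by (subst memb) auto
  then show "conj_subgroup G g K \<noteq> {}" by auto
  fix a assume a: "a \<in> conj_subgroup G g K"
  then have aK: "inv g \<otimes> a \<otimes> g \<in> K" by (simp only: memb[OF carr[OF a]])
  have "inv (inv g \<otimes> a \<otimes> g) = inv g \<otimes> inv a \<otimes> g"
    using g carr[OF a] by (simp add: inv_mult_group m_assoc)
  then have "inv g \<otimes> inv a \<otimes> g \<in> K"
    using subgroup.m_inv_closed[OF K aK] by simp
  then show "inv a \<in> conj_subgroup G g K"
    using carr[OF a] by (subst memb) auto
  fix b assume b: "b \<in> conj_subgroup G g K"
  then have bK: "inv g \<otimes> b \<otimes> g \<in> K" by (simp only: memb[OF carr[OF b]])
  have "(inv g \<otimes> a \<otimes> g) \<otimes> (inv g \<otimes> b \<otimes> g) = inv g \<otimes> (a \<otimes> b) \<otimes> g"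
    using g carr[OF a] carr[OF b] by (simp add: m_assoc inv_mult_cancel)
  then have "inv g \<otimes> (a \<otimes> b) \<otimes> g \<in> K"
    using subgroup.m_closed[OF K aK bK] by simp
  then show "a \<otimes> b \<in> conj_subgroup G g K"
    using carr[OF a] carr[OF b] by (subst memb) auto
qed

text \<open>Right multiplication by \<open>g\<close> is an isomorphism of left \<open>G\<close>-sets from \<open>G/K\<close> to \<open>G/(g^-1 Kg)\<close>.\<close>

lemma r_coset_eq_l_coset_conj:
  assumes "g \<in> carrier G" "h \<in> carrier G" "K \<subseteq> carrier G"
  shows "(h <# K) #> g = (h \<otimes> g) <# conj_subgroup G (inv g) K"
  using assms unfolding conj_subgroup_def
  by (simp add: coset_assoc l_coset_subset_G lcos_m_assoc m_assoc)

section \<open>Pairs of cosets under the diagonal action\<close>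

definition diag_act :: "'a \<Rightarrow> 'a set \<times> 'a set \<Rightarrow> 'a set \<times> 'a set" where
  "diag_act g p = (g <# fst p, g <# snd p)"

definition diag_orbit :: "'a set \<times> 'a set \<Rightarrow> ('a set \<times> 'a set) set" where
  "diag_orbit p = (\<lambda>g. diag_act g p) ` carrier G"

lemma diag_orbit_self:
  assumes "C \<subseteq> carrier G" "D \<subseteq> carrier G"
  shows "(C, D) \<in> diag_orbit (C, D)"
  unfolding diag_orbit_def diag_act_def
  by (rule image_eqI[of _ _ \<one>]) (use assms in \<open>auto simp: lcos_mult_one\<close>)

lemma diag_act_act:
  assumes "C \<subseteq> carrier G" "D \<subseteq> carrier G" "g \<in> carrier G" "h \<in> carrier G"
  shows "diag_act h (g <# C, g <# D) = diag_act (h \<otimes> g) (C, D)"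
  using assms by (simp add: diag_act_def lcos_m_assoc)

lemma diag_orbit_act:
  assumes CD: "C \<subseteq> carrier G" "D \<subseteq> carrier G" and g: "g \<in> carrier G"
  shows "diag_orbit (g <# C, g <# D) = diag_orbit (C, D)"
proof -
  have "diag_orbit (g <# C, g <# D) = (\<lambda>h. diag_act (h \<otimes> g) (C, D)) ` carrier G"
    unfolding diag_orbit_def by (rule image_cong[OF refl]) (rule diag_act_act[OF CD g])
  also have "\<dots> = (\<lambda>h. diag_act h (C, D)) ` (\<lambda>h. h \<otimes> g) ` carrier G"
    by (simp add: image_image)
  also have "(\<lambda>h. h \<otimes> g) ` carrier G = carrier G"
  proof
    show "carrier G \<subseteq> (\<lambda>h. h \<otimes> g) ` carrier G"
    proof
      fix x assume x: "x \<in> carrier G"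
      then have "x = (x \<otimes> inv g) \<otimes> g" using g by (simp add: m_assoc)
      then show "x \<in> (\<lambda>h. h \<otimes> g) ` carrier G" using x g by blast
    qed
  qed (use g in auto)
  finally show ?thesis unfolding diag_orbit_def .
qed

text \<open>Write \<open>L = g^-1 K g\<close>. The map \<open>(C, D) \<mapsto> C \<inter> Dg\<close> sends \<open>(hgH, hK)\<close> to \<open>hgH \<inter> hgL = hg(H \<inter> L)\<close>. So it is
  an isomorphism from the orbit of \<open>(gH, K)\<close> to the coset space of \<open>H \<inter> L\<close>.\<close>

lemma reiter_if_reiter_on_orbit:
  assumes H: "subgroup H G" and K: "subgroup K G" and g: "g \<in> carrier G" and S: "S \<subseteq> carrier G"
    and R: "R \<subseteq> diag_orbit (g <# H, K)" "reiter_on diag_act S \<delta> R"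
  shows "reiter G S \<delta> (H \<inter> conj_subgroup G (inv g) K)"
proof -
  define L where "L = conj_subgroup G (inv g) K"
  have L: "subgroup L G"
    unfolding L_def by (rule subgroup_conj_subgroup[OF inv_closed[OF g] K])
  note HL = subgroups_Inter_pair[OF H L]
  note sub = subgroup.subset[OF H] subgroup.subset[OF K] subgroup.subset[OF L]
  define X where "X = diag_orbit (g <# H, K)"
  define \<theta> where "\<theta> p = fst p \<inter> (snd p #> g)" for p
  have conj: "(h <# K) #> g = (h \<otimes> g) <# L" if "h \<in> carrier G" for h
    unfolding L_def by (rule r_coset_eq_l_coset_conj[OF g that sub(2)])
  have \<theta>: "\<theta> (diag_act h (g <# H, K)) = (h \<otimes> g) <# (H \<inter> L)" if h: "h \<in> carrier G" for h
    unfolding \<theta>_def diag_act_def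
    by (simp add: conj h lcos_m_assoc[OF sub(1) h g] l_coset_Int[OF m_closed[OF h g] sub(1,3)])
  have act: "diag_act s (diag_act h (g <# H, K)) = diag_act (s \<otimes> h) (g <# H, K)"
    if "s \<in> carrier G" "h \<in> carrier G" for s h
    using diag_act_act[OF l_coset_subset_G[OF sub(1) g] sub(2) that(2,1)]
    by (simp add: diag_act_def)
  have X: "\<exists>h\<in>carrier G. p = diag_act h (g <# H, K)" if "p \<in> X" for p
    using that unfolding X_def diag_orbit_def by (rule imageE) (rule bexI)
  have X_act: "diag_act s p \<in> X" and \<theta>_act: "s <# \<theta> p = \<theta> (diag_act s p)"
    if s: "s \<in> S" and p: "p \<in> X" for s p
  proof -
    obtain h where h: "h \<in> carrier G" "p = diag_act h (g <# H, K)" using X[OF p] by blast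
    have s': "s \<in> carrier G" using s S by (rule subsetD[rotated])
    have eq: "diag_act s p = diag_act (s \<otimes> h) (g <# H, K)"
      unfolding h(2) by (rule act[OF s' h(1)])
    show "diag_act s p \<in> X"
      unfolding eq X_def diag_orbit_def by (rule imageI[OF m_closed[OF s' h(1)]])
    show "s <# \<theta> p = \<theta> (diag_act s p)"
      unfolding eq \<theta>[OF m_closed[OF s' h(1)]] unfolding h(2) \<theta>[OF h(1)]
      using lcos_m_assoc[OF subgroup.subset[OF HL] s' m_closed[OF h(1) g]] m_assoc[OF s' h(1) g]
      by simp
  qed
  have inj: "inj_on \<theta> X"
  proof (rule inj_onI)
    fix p q assume pX: "p \<in> X" and qX: "q \<in> X" and pq: "\<theta> p = \<theta> q"
    obtain h where h: "h \<in> carrier G" "p = diag_act h (g <# H, K)" using X[OF pX] by blast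
    obtain k where k: "k \<in> carrier G" "q = diag_act k (g <# H, K)" using X[OF qX] by blast
    note hg = m_closed[OF h(1) g] and kg = m_closed[OF k(1) g]
    have "inv (h \<otimes> g) \<otimes> (k \<otimes> g) \<in> H \<inter> L"
      using pq unfolding h(2) k(2) \<theta>[OF h(1)] \<theta>[OF k(1)] l_coset_eq_iff[OF HL hg kg] .
    then have "(h \<otimes> g) <# H = (k \<otimes> g) <# H" "(h \<otimes> g) <# L = (k \<otimes> g) <# L"
      unfolding l_coset_eq_iff[OF H hg kg] l_coset_eq_iff[OF L hg kg] by blast+
    then have eqH: "h <# (g <# H) = k <# (g <# H)" and eqK: "(h <# K) #> g = (k <# K) #> g"
      by (simp_all only: lcos_m_assoc[OF sub(1) _ g] h k conj)
    have "((h <# K) #> g) #> inv g = ((k <# K) #> g) #> inv g"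
      by (simp only: eqK)
    then have "h <# K = k <# K"
      by (simp add: coset_mult_assoc coset_mult_one l_coset_subset_G sub(2) g h(1) k(1))
    then show "p = q" unfolding h(2) k(2) diag_act_def by (simp add: eqH)
  qed
  have RX: "R \<subseteq> X" using R(1) unfolding X_def .
  have "reiter_on (l_coset G) S \<delta> (\<theta> ` R)"
  proof (rule reiter_on_image[OF R(2)])
    show "inj_on \<theta> R" by (rule inj_on_subset[OF inj RX])
    fix s p assume s: "s \<in> S" and p: "p \<in> R"
    note pX = subsetD[OF RX p]
    show "s <# \<theta> p = \<theta> (diag_act s p)" by (rule \<theta>_act[OF s pX])
    assume "s <# \<theta> p \<in> \<theta> ` R"
    then have "\<theta> (diag_act s p) \<in> \<theta> ` R" unfolding \<theta>_act[OF s pX] .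
    then show "diag_act s p \<in> R"
      unfolding inj_on_image_mem_iff[OF inj X_act[OF s pX] RX] .
  qed
  moreover have "\<theta> ` R \<subseteq> lcosets (H \<inter> L)"
  proof
    fix C assume "C \<in> \<theta> ` R"
    then obtain p where p: "p \<in> R" "C = \<theta> p" by blast
    obtain h where h: "h \<in> carrier G" "p = diag_act h (g <# H, K)"
      using X[OF subsetD[OF RX p(1)]] by blast
    have "C = (h \<otimes> g) <# (H \<inter> L)" unfolding p(2) h(2) by (rule \<theta>[OF h(1)])
    then show "C \<in> lcosets (H \<inter> L)"
      unfolding LCOSETS_def using m_closed[OF h(1) g] by blast
  qed
  ultimately show ?thesis unfolding reiter_def L_def by blast
qed

text \<open>The sum over \<open>C\<close> is the bad mass in the fibre over \<open>K\<close>, where \<open>(gH, K)\<close> counts as bad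
  if the isomorphic coset space of \<open>H \<inter> g^-1 K g\<close> has no Reiter function. The fibre over \<open>gK\<close> with
  \<open>g \<in> T\<close> has at least the same bad mass up to the loss of \<open>u\<close> under \<open>g\<close>, so the left-hand side is
  a lower bound for \<open>\<delta>\<close> times the total bad mass of the product function. The right-hand side is an
  upper bound for the loss of that function.\<close>

lemma non_reiter_mass_bound:
  assumes H: "subgroup H G" and K: "subgroup K G"
    and S: "S \<subseteq> carrier G" and T: "finite T" "T \<subseteq> carrier G"
    and U: "finite U" "U \<subseteq> lcosets H"
    and rep: "\<And>C. C \<in> U \<Longrightarrow> rep C \<in> carrier G" "\<And>C. C \<in> U \<Longrightarrow> C = rep C <# H"
    and u: "\<And>C. 0 \<le> u C" "\<And>C. C \<notin> U \<Longrightarrow> u C = 0"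
    and v: "\<And>D. 0 \<le> v D" "\<And>D. D \<notin> (\<lambda>g. g <# K) ` T \<Longrightarrow> v D = 0"
    and \<delta>: "0 \<le> \<delta>"
  defines "V \<equiv> (\<lambda>g. g <# K) ` T"
  shows "\<delta> * (((\<Sum>C | C \<in> U \<and> \<not> reiter G S \<delta> (H \<inter> conj_subgroup G (inv (rep C)) K). u C)
             - loss (l_coset G) T U u) * sum v V)
    \<le> loss (l_coset G) S U u * sum v V + sum u U * loss (l_coset G) S V v"
proof -
  define B where "B = {C\<in>U. \<not> reiter G S \<delta> (H \<inter> conj_subgroup G (inv (rep C)) K)}"
  define w where "w p = u (fst p) * v (snd p)" for p
  define bad where "bad p \<longleftrightarrow>
    \<not> reiter_on diag_act S \<delta> {q \<in> U \<times> V. diag_orbit q = diag_orbit p}" for p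
  have fin: "finite (U \<times> V)" "finite V" "finite B" using U T by (auto simp: V_def B_def)
  have U_sub: "C \<subseteq> carrier G" if "C \<in> U" for C
    by (rule lcosets_subset_carrier[OF H subsetD[OF U(2) that]])
  have K_sub: "K \<subseteq> carrier G" using K subgroup.subset by auto
  have V_sub: "D \<subseteq> carrier G" if D: "D \<in> V" for D
  proof -
    obtain g where "g \<in> T" "D = g <# K" using D unfolding V_def by blast
    then show ?thesis using l_coset_subset_G[OF K_sub] subsetD[OF T(2)] by simp
  qed
  \<comment> \<open>The pair (gC, gK) lies in the orbit of (C, K).\<close>
  have bad_shift: "bad (g <# C, g <# K)" if C: "C \<in> B" and g: "g \<in> T" for C g
    unfolding bad_def
  proof
    have CU: "C \<in> U" using C by (simp add: B_def)
    have gG: "g \<in> carrier G" using g T(2) by (rule subsetD[rotated])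
    have orbit: "diag_orbit (g <# C, g <# K) = diag_orbit (rep C <# H, K)"
      unfolding diag_orbit_act[OF U_sub[OF CU] K_sub gG] using rep(2)[OF CU] by simp
    have "{q \<in> U \<times> V. diag_orbit q = diag_orbit (g <# C, g <# K)} \<subseteq> diag_orbit (rep C <# H, K)"
    proof
      fix q assume q: "q \<in> {q \<in> U \<times> V. diag_orbit q = diag_orbit (g <# C, g <# K)}"
      then have "fst q \<in> U" "snd q \<in> V" by auto
      then have "q \<in> diag_orbit q"
        using diag_orbit_self[OF U_sub V_sub, of "fst q" "snd q"] by simp
      then show "q \<in> diag_orbit (rep C <# H, K)" using q orbit by simp
    qed
    moreover assume "reiter_on diag_act S \<delta>
      {q \<in> U \<times> V. diag_orbit q = diag_orbit (g <# C, g <# K)}"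
    ultimately have "reiter G S \<delta> (H \<inter> conj_subgroup G (inv (rep C)) K)"
      by (rule reiter_if_reiter_on_orbit[OF H K rep(1)[OF CU] S])
    then show False using C by (simp add: B_def)
  qed
  have mass_shift: "(\<Sum>C\<in>B. u C) - loss (l_coset G) T U u \<le> (\<Sum>C | C \<in> U \<and> bad (C, D). u C)"
    if D: "D \<in> V" for D
  proof -
    obtain g where g: "g \<in> T" "D = g <# K" using D unfolding V_def by blast
    have gG: "g \<in> carrier G" using g(1) T(2) by (rule subsetD[rotated])
    have inj: "inj_on (l_coset G g) B"
      by (rule inj_on_subset[OF inj_on_l_coset[OF gG]]) (use U_sub in \<open>auto simp: B_def\<close>)
    have "(\<Sum>C\<in>B. max 0 (u C - u (g <# C))) \<le> (\<Sum>C\<in>U. max 0 (u C - u (g <# C)))"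
      by (rule sum_mono2) (use U in \<open>auto simp: B_def\<close>)
    also have "\<dots> = loss (l_coset G) {g} U u"
      by (simp add: loss_def)
    also have "\<dots> \<le> loss (l_coset G) T U u"
      by (rule loss_mono_elements) (use g T in auto)
    finally have "(\<Sum>C\<in>B. u C) - loss (l_coset G) T U u
        \<le> (\<Sum>C\<in>B. u C) - (\<Sum>C\<in>B. max 0 (u C - u (g <# C)))" by simp
    also have "\<dots> = (\<Sum>C\<in>B. u C - max 0 (u C - u (g <# C)))"
      by (simp add: sum_subtractf)
    also have "\<dots> \<le> (\<Sum>C\<in>B. u (g <# C))"
      by (rule sum_mono) auto
    also have "\<dots> = sum u (l_coset G g ` B)"
      using inj by (simp add: sum.reindex)
    also have "\<dots> = sum u (l_coset G g ` B \<inter> U)"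
      by (rule sum.mono_neutral_right) (use fin u in auto)
    also have "\<dots> \<le> (\<Sum>C | C \<in> U \<and> bad (C, D). u C)"
      by (rule sum_mono2) (use U u bad_shift g in auto)
    finally show ?thesis .
  qed
  have "(\<Sum>C\<in>B. u C) * sum v V - loss (l_coset G) T U u * sum v V
      = (\<Sum>D\<in>V. ((\<Sum>C\<in>B. u C) - loss (l_coset G) T U u) * v D)"
    by (simp add: sum_distrib_left left_diff_distrib sum_subtractf)
  also have "\<dots> \<le> (\<Sum>D\<in>V. (\<Sum>C | C \<in> U \<and> bad (C, D). u C) * v D)"
    by (intro sum_mono mult_right_mono mass_shift v(1))
  also have "\<dots> = (\<Sum>D\<in>V. \<Sum>C\<in>U. if bad (C, D) then w (C, D) else 0)"
    by (rule sum.cong[OF refl])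
      (auto simp: sum_distrib_right w_def sum.inter_filter[OF U(1)] intro!: sum.cong)
  also have "\<dots> = (\<Sum>p\<in>U \<times> V. if bad p then w p else 0)"
    unfolding sum.swap[of _ U V] by (simp add: sum.cartesian_product split_def cong: if_cong)
  also have "\<dots> = (\<Sum>p | p \<in> U \<times> V \<and> bad p. w p)"
    using fin by (simp add: sum.inter_filter)
  finally have "\<delta> * (((\<Sum>C\<in>B. u C) - loss (l_coset G) T U u) * sum v V)
      \<le> \<delta> * (\<Sum>p | p \<in> U \<times> V \<and> bad p. w p)"
    using \<delta> by (simp add: mult_left_mono left_diff_distrib)
  also have "\<dots> \<le> loss diag_act S (U \<times> V) w"
    unfolding bad_def
  proof (rule mass_of_non_reiter_classes_le_loss[OF fin(1)])
    show "0 \<le> w p" for p using u v by (simp add: w_def split_def)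
    show "w p = 0" if "p \<notin> U \<times> V" for p
      using that u v(2) unfolding w_def V_def mem_Times_iff by auto
    show "diag_orbit (diag_act s p) = diag_orbit p" if "s \<in> S" "p \<in> U \<times> V" for s p
    proof -
      have "s \<in> carrier G" "fst p \<in> U" "snd p \<in> V" using that S by auto
      then show ?thesis
        using diag_orbit_act[OF U_sub V_sub, of "fst p" "snd p" s] by (simp add: diag_act_def)
    qed
  qed
  also have "\<dots> \<le> loss (l_coset G) S U u * sum v V + sum u U * loss (l_coset G) S V v"
    unfolding diag_act_def w_def
  proof (rule loss_product)
    show "inj_on (l_coset G s) V" if "s \<in> S" for s
      by (rule inj_on_subset[OF inj_on_l_coset[OF subsetD[OF S that]]]) (use V_sub in auto)
  qed (use U fin u v in \<open>auto simp: V_def\<close>)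
  finally show ?thesis unfolding B_def .
qed

end

section \<open>The averaging operator and almost invariant functions\<close>

lemma integral_count_space_eq_infsum:
  fixes g :: "'x \<Rightarrow> real"
  assumes "integrable (count_space X) g"
  shows "g summable_on X" "(LINT x|count_space X. g x) = (\<Sum>\<^sub>\<infinity>x\<in>X. g x)"
proof -
  have *: "Infinite_Set_Sum.abs_summable_on g X"
    using assms by (simp add: Infinite_Set_Sum.abs_summable_on_def)
  then show "g summable_on X"
    using abs_summable_equivalent abs_summable_summable by blast
  show "(LINT x|count_space X. g x) = (\<Sum>\<^sub>\<infinity>x\<in>X. g x)"
    using infsetsum_infsum[OF *] by (simp add: infsetsum_def)
qed

lemma sum_le_integral_count_space:
  fixes g :: "'x \<Rightarrow> real"
  assumes "integrable (count_space X) g" "\<And>x. 0 \<le> g x" "finite T" "T \<subseteq> X"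
  shows "sum g T \<le> (LINT x|count_space X. g x)"
  using assms integral_count_space_eq_infsum[OF assms(1)] by (simp add: finite_sum_le_infsum)

lemma integral_count_space_approx:
  fixes g :: "'x \<Rightarrow> real"
  assumes g: "integrable (count_space X) g" and "0 < \<epsilon>"
  obtains T where "finite T" "T \<subseteq> X" "(LINT x|count_space X. g x) - \<epsilon> \<le> sum g T"
proof -
  obtain T where T: "finite T" "T \<subseteq> X" "dist (sum g T) (\<Sum>\<^sub>\<infinity>x\<in>X. g x) \<le> \<epsilon>"
    using infsum_finite_approximation[OF integral_count_space_eq_infsum(1)[OF g] \<open>0 < \<epsilon>\<close>] by blast
  then show thesis
    using that integral_count_space_eq_infsum(2)[OF g] by (simp add: dist_real_def)
qed

text \<open>The variance identity. It quantifies uniform convexity: if an average of vectors of equal length is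
  nearly as long as these vectors, then they are close to each other.\<close>

lemma sum_squared_differences:
  fixes z :: "'s \<Rightarrow> complex"
  assumes "finite S"
  shows "(\<Sum>s\<in>S. \<Sum>t\<in>S. (cmod (z s - z t))\<^sup>2)
    = 2 * card S * (\<Sum>s\<in>S. (cmod (z s))\<^sup>2) - 2 * (cmod (\<Sum>s\<in>S. z s))\<^sup>2"
proof -
  have real: "(\<Sum>s\<in>S. \<Sum>t\<in>S. (a s - a t)\<^sup>2) = 2 * card S * (\<Sum>s\<in>S. (a s)\<^sup>2) - 2 * (\<Sum>s\<in>S. a s)\<^sup>2"
    for a :: "'s \<Rightarrow> real"
  proof -
    have "(\<Sum>s\<in>S. \<Sum>t\<in>S. (a s - a t)\<^sup>2)
        = (\<Sum>s\<in>S. \<Sum>t\<in>S. (a s)\<^sup>2) + (\<Sum>s\<in>S. \<Sum>t\<in>S. (a t)\<^sup>2) - 2 * (\<Sum>s\<in>S. \<Sum>t\<in>S. a s * a t)"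
      by (simp add: power2_diff sum.distrib sum_subtractf sum_distrib_left mult.assoc)
    also have "(\<Sum>s\<in>S. \<Sum>t\<in>S. a s * a t) = (\<Sum>s\<in>S. a s)\<^sup>2"
      by (simp add: power2_eq_square sum_product)
    finally show ?thesis by (simp add: sum_distrib_left mult.assoc)
  qed
  have "(\<Sum>s\<in>S. \<Sum>t\<in>S. (cmod (z s - z t))\<^sup>2)
      = (\<Sum>s\<in>S. \<Sum>t\<in>S. (Re (z s) - Re (z t))\<^sup>2) + (\<Sum>s\<in>S. \<Sum>t\<in>S. (Im (z s) - Im (z t))\<^sup>2)"
    by (simp add: cmod_power2 sum.distrib)
  then show ?thesis
    unfolding real by (simp add: cmod_power2 sum.distrib algebra_simps)
qed

lemma norm_average_squared:
  fixes z :: "'s \<Rightarrow> complex"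
  assumes "finite S" "S \<noteq> {}"
  shows "(cmod (1 / of_nat (card S) * (\<Sum>s\<in>S. z s)))\<^sup>2
    = (\<Sum>s\<in>S. (cmod (z s))\<^sup>2) / card S - (\<Sum>s\<in>S. \<Sum>t\<in>S. (cmod (z s - z t))\<^sup>2) / (2 * (card S)\<^sup>2)"
proof -
  have "card S > 0" using assms by (simp add: card_gt_0_iff)
  then show ?thesis
    unfolding sum_squared_differences[OF assms(1)]
    by (simp add: norm_mult norm_divide power_mult_distrib power_divide field_simps power2_eq_square)
qed

text \<open>The variance identity integrates to an exact formula for squared norms.\<close>

definition l2_energy :: "'x set \<Rightarrow> ('x \<Rightarrow> complex) \<Rightarrow> real" where
  "l2_energy X \<phi> = (LINT x|count_space X. (cmod (\<phi> x))\<^sup>2)"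

lemma l2_norm_eq: "l2_norm X \<phi> = sqrt (l2_energy X \<phi>)"
  by (simp add: l2_norm_def l2_energy_def)

lemma l2_energy_nonneg: "0 \<le> l2_energy X \<phi>"
  by (simp add: l2_energy_def)

lemma l2_space_diff:
  assumes "\<phi> \<in> l2_space X" "\<psi> \<in> l2_space X"
  shows "(\<lambda>x. \<phi> x - \<psi> x) \<in> l2_space X"
proof -
  have "integrable (count_space X) (\<lambda>x. 2 * (cmod (\<phi> x))\<^sup>2 + 2 * (cmod (\<psi> x))\<^sup>2)"
    using assms by (simp add: l2_space_def)
  moreover have "norm ((cmod (\<phi> x - \<psi> x))\<^sup>2) \<le> norm (2 * (cmod (\<phi> x))\<^sup>2 + 2 * (cmod (\<psi> x))\<^sup>2)" for x
  proof -
    have "(cmod (\<phi> x - \<psi> x))\<^sup>2 \<le> (cmod (\<phi> x) + cmod (\<psi> x))\<^sup>2"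
      by (intro power_mono norm_triangle_ineq4) auto
    also have "\<dots> \<le> 2 * (cmod (\<phi> x))\<^sup>2 + 2 * (cmod (\<psi> x))\<^sup>2"
      using zero_le_power2[of "cmod (\<phi> x) - cmod (\<psi> x)"]
      by (simp add: power2_sum power2_diff)
    finally show ?thesis by simp
  qed
  ultimately show ?thesis
    unfolding l2_space_def by (auto intro: Bochner_Integration.integrable_bound)
qed

lemma l2_shift:
  assumes "bij_betw a X X"
  shows "(\<lambda>x. \<phi> (a x)) \<in> l2_space X \<longleftrightarrow> \<phi> \<in> l2_space X"
    and "l2_energy X (\<lambda>x. \<phi> (a x)) = l2_energy X \<phi>"
  using integrable_bij_count_space[OF assms, of "\<lambda>x. (cmod (\<phi> x))\<^sup>2"]
    integral_bij_count_space[OF assms, of "\<lambda>x. (cmod (\<phi> x))\<^sup>2"]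
  by (simp_all add: l2_space_def l2_energy_def)

lemma l2_energy_average:
  assumes S: "finite S" "S \<noteq> {}" and bij: "\<And>s. s \<in> S \<Longrightarrow> bij_betw (act s) X X"
    and \<phi>: "\<phi> \<in> l2_space X"
  defines "A \<equiv> \<lambda>x. 1 / of_nat (card S) * (\<Sum>s\<in>S. \<phi> (act s x))"
  shows "A \<in> l2_space X"
    and "l2_energy X A = l2_energy X \<phi>
      - (\<Sum>s\<in>S. \<Sum>t\<in>S. l2_energy X (\<lambda>x. \<phi> (act s x) - \<phi> (act t x))) / (2 * (card S)\<^sup>2)"
proof -
  have n: "card S > 0" using S by (simp add: card_gt_0_iff)
  have shift: "integrable (count_space X) (\<lambda>x. (cmod (\<phi> (act s x)))\<^sup>2)" if "s \<in> S" for s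
    using l2_shift(1)[OF bij[OF that], of \<phi>] \<phi> by (simp add: l2_space_def)
  have diff: "integrable (count_space X) (\<lambda>x. (cmod (\<phi> (act s x) - \<phi> (act t x)))\<^sup>2)"
    if "s \<in> S" "t \<in> S" for s t
    using l2_space_diff[of "\<lambda>x. \<phi> (act s x)" X "\<lambda>x. \<phi> (act t x)"] shift that
    by (simp add: l2_space_def)
  have A: "(cmod (A x))\<^sup>2 = (\<Sum>s\<in>S. (cmod (\<phi> (act s x)))\<^sup>2) / card S
      - (\<Sum>s\<in>S. \<Sum>t\<in>S. (cmod (\<phi> (act s x) - \<phi> (act t x)))\<^sup>2) / (2 * (card S)\<^sup>2)" for x
    unfolding A_def by (rule norm_average_squared[OF S])
  show "A \<in> l2_space X"
    unfolding l2_space_def mem_Collect_eq A using shift diff by simp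
  have "(LINT x|count_space X. (cmod (\<phi> (act s x)))\<^sup>2) = l2_energy X \<phi>" if "s \<in> S" for s
    using l2_shift(2)[OF bij[OF that], of \<phi>] by (simp add: l2_energy_def)
  then have "(\<Sum>s\<in>S. LINT x|count_space X. (cmod (\<phi> (act s x)))\<^sup>2) / card S = l2_energy X \<phi>"
    using n by simp
  then show "l2_energy X A = l2_energy X \<phi>
      - (\<Sum>s\<in>S. \<Sum>t\<in>S. l2_energy X (\<lambda>x. \<phi> (act s x) - \<phi> (act t x))) / (2 * (card S)\<^sup>2)"
    unfolding l2_energy_def A using shift diff by simp
qed

text \<open>For \<open>a \<ge> b\<close> this is \<open>a^2 - b^2 \<le> 2 a (a - b)\<close> followed by the inequality of arithmetic and geometric means,
  weighted by \<open>\<kappa>\<close>. Applied pointwise it takes the place of the Cauchy-Schwarz inequality in passing from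
  \<open>\<ell>\<^sup>2\<close> to \<open>\<ell>\<^sup>1\<close>.\<close>

lemma diff_squares_le:
  fixes a b \<kappa> :: real
  assumes "0 \<le> a" "0 \<le> b" "0 < \<kappa>"
  shows "max 0 (a\<^sup>2 - b\<^sup>2) \<le> \<kappa> * a\<^sup>2 + (a - b)\<^sup>2 / \<kappa>"
proof (cases "b \<le> a")
  case True
  have "a\<^sup>2 - b\<^sup>2 = (a - b) * (a + b)" by (simp add: power2_eq_square algebra_simps)
  also have "\<dots> \<le> (a - b) * (2 * a)" using True assms by (intro mult_left_mono) auto
  also have "\<dots> \<le> \<kappa> * a\<^sup>2 + (a - b)\<^sup>2 / \<kappa>"
  proof -
    have "0 \<le> (\<kappa> * a - (a - b))\<^sup>2 / \<kappa>" using assms by simp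
    also have "\<dots> = \<kappa> * a\<^sup>2 + (a - b)\<^sup>2 / \<kappa> - (a - b) * (2 * a)"
      using assms by (simp add: power2_eq_square field_simps)
    finally show ?thesis by simp
  qed
  finally show ?thesis using assms by simp
next
  case False
  then have "a\<^sup>2 \<le> b\<^sup>2" using assms by (intro power_mono) auto
  then show ?thesis using assms by simp
qed

text \<open>The Reiter function is the square of \<open>cmod \<phi>\<close>, cut off outside a finite set. With \<open>N\<close> the energy
  of \<open>\<phi>\<close>, passing to squares costs \<open>2 * \<kappa> * N\<close> for each \<open>s\<close> and the cut-off costs another \<open>\<kappa> * N\<close>, while a
  mass of at least \<open>(1 - \<kappa>) * N\<close> is left. The value of \<open>\<kappa>\<close> gives \<open>3 * card S * \<kappa> < \<delta> * (1 - \<kappa>)\<close>.\<close>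

lemma reiter_on_if_l2_almost_invariant:
  fixes \<delta> \<kappa> :: real
  assumes S: "finite S" and bij: "\<And>s. s \<in> S \<Longrightarrow> bij_betw (act s) X X"
    and \<phi>: "\<phi> \<in> l2_space X" "0 < l2_energy X \<phi>" and \<delta>: "0 < \<delta>"
    and \<kappa>: "\<kappa> = \<delta> / (3 * card S + \<delta> + 1)"
    and small: "\<And>s. s \<in> S \<Longrightarrow> l2_energy X (\<lambda>x. \<phi> x - \<phi> (act s x)) \<le> \<kappa>\<^sup>2 * l2_energy X \<phi>"
  shows "\<exists>T\<subseteq>X. reiter_on act S \<delta> T"
proof -
  define N where "N = l2_energy X \<phi>"
  have \<kappa>0: "0 < \<kappa>" using \<delta> by (simp add: \<kappa>)
  have N: "0 < N" using \<phi> by (simp add: N_def)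
  define f where "f x = (cmod (\<phi> x))\<^sup>2" for x
  have f: "integrable (count_space X) f" "(LINT x|count_space X. f x) = N"
    using \<phi> by (simp_all add: f_def[abs_def] l2_space_def N_def l2_energy_def)
  have f0: "0 \<le> f x" for x by (simp add: f_def)
  obtain T where T: "finite T" "T \<subseteq> X" "N - \<kappa> * N \<le> sum f T"
    using integral_count_space_approx[OF f(1), of "\<kappa> * N"] \<kappa>0 N f(2) by auto
  define f' where "f' x = (if x \<in> T then f x else 0)" for x
  have sum_f': "sum f' T = sum f T" by (simp add: f'_def)
  have drop: "(\<Sum>x\<in>T. max 0 (f' x - f' (act s x))) \<le> 3 * \<kappa> * N" if s: "s \<in> S" for s
  proof -
    define d where "d x = (cmod (\<phi> x - \<phi> (act s x)))\<^sup>2" for x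
    have shift: "(\<lambda>x. \<phi> (act s x)) \<in> l2_space X" using l2_shift(1)[OF bij[OF s]] \<phi> by blast
    have d: "integrable (count_space X) d" "(LINT x|count_space X. d x) \<le> \<kappa>\<^sup>2 * N"
      using l2_space_diff[OF \<phi>(1) shift] small[OF s]
      by (simp_all add: d_def[abs_def] l2_space_def N_def l2_energy_def)
    have T_shift: "(\<Sum>x\<in>T. f (act s x) - f' (act s x)) \<le> \<kappa> * N"
    proof -
      have inj: "inj_on (act s) T"
        using bij[OF s] T(2) by (meson bij_betw_imp_inj_on inj_on_subset)
      have sub: "act s ` T \<subseteq> X" using bij[OF s] T(2) by (auto simp: bij_betw_def)
      have "(\<Sum>x\<in>T. f (act s x) - f' (act s x)) = (\<Sum>y\<in>act s ` T. f y - f' y)"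
        using inj by (simp add: sum.reindex)
      also have "\<dots> \<le> (\<Sum>y\<in>act s ` T \<union> T. f y - f' y)"
        by (rule sum_mono2) (use T f0 in \<open>auto simp: f'_def\<close>)
      also have "\<dots> = sum f (act s ` T \<union> T) - sum f' T"
        using T by (simp add: sum_subtractf) (rule sum.mono_neutral_right, auto simp: f'_def)
      also have "\<dots> \<le> N - sum f T"
        using sum_le_integral_count_space[OF f(1) f0, of "act s ` T \<union> T"] T sub f(2) sum_f' by auto
      finally show ?thesis using T(3) by simp
    qed
    have "(\<Sum>x\<in>T. max 0 (f' x - f' (act s x)))
        \<le> (\<Sum>x\<in>T. (\<kappa> * f x + d x / \<kappa>) + (f (act s x) - f' (act s x)))"
    proof (rule sum_mono)
      fix x assume x: "x \<in> T"
      have "max 0 (f x - f (act s x)) \<le> \<kappa> * f x + (cmod (\<phi> x) - cmod (\<phi> (act s x)))\<^sup>2 / \<kappa>"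
        unfolding f_def by (rule diff_squares_le) (use \<kappa>0 in auto)
      also have "\<dots> \<le> \<kappa> * f x + d x / \<kappa>"
        unfolding d_def using \<kappa>0
        by (intro add_left_mono divide_right_mono) (auto simp: norm_triangle_ineq3 abs_le_square_iff[symmetric])
      finally show "max 0 (f' x - f' (act s x))
          \<le> (\<kappa> * f x + d x / \<kappa>) + (f (act s x) - f' (act s x))"
        using x f0[of "act s x"] by (auto simp: f'_def)
    qed
    also have "\<dots> = \<kappa> * sum f T + sum d T / \<kappa> + (\<Sum>x\<in>T. f (act s x) - f' (act s x))"
      by (simp add: sum.distrib sum_distrib_left sum_divide_distrib)
    also have "\<dots> \<le> \<kappa> * N + \<kappa> * N + \<kappa> * N"
    proof (intro add_mono T_shift)
      show "\<kappa> * sum f T \<le> \<kappa> * N"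
        using sum_le_integral_count_space[OF f(1) f0 T(1,2)] f(2) \<kappa>0 by simp
      have "sum d T \<le> \<kappa>\<^sup>2 * N"
        using sum_le_integral_count_space[OF d(1) _ T(1,2)] d(2) by (force simp: d_def)
      then show "sum d T / \<kappa> \<le> \<kappa> * N"
        using \<kappa>0 by (simp add: power2_eq_square field_simps)
    qed
    finally show ?thesis by (simp add: algebra_simps)
  qed
  have "loss act S T f' \<le> card S * (3 * \<kappa> * N)"
    unfolding loss_def using sum_bounded_above[of S _ "3 * \<kappa> * N"] drop by simp
  also have "\<dots> < \<delta> * ((1 - \<kappa>) * N)"
  proof -
    have "3 * real (card S) + \<delta> + 1 > 0" using \<delta> by linarith
    then have "\<kappa> * (3 * real (card S) + \<delta> + 1) = \<delta>" by (simp add: \<kappa>)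
    moreover have "\<kappa> * (3 * real (card S) + \<delta> + 1) = real (card S) * (3 * \<kappa>) + \<delta> * \<kappa> + \<kappa>"
      by (simp add: distrib_left distrib_right mult.commute mult.left_commute)
    moreover have "\<delta> * (1 - \<kappa>) = \<delta> - \<delta> * \<kappa>" by (simp add: right_diff_distrib)
    ultimately have "real (card S) * (3 * \<kappa>) < \<delta> * (1 - \<kappa>)" using \<kappa>0 by linarith
    then have "real (card S) * (3 * \<kappa>) * N < \<delta> * (1 - \<kappa>) * N"
      using N by (rule mult_strict_right_mono)
    then show ?thesis by (simp only: mult.assoc)
  qed
  also have "\<dots> \<le> \<delta> * sum f' T"
    unfolding sum_f'
    by (rule mult_left_mono) (use T(3) \<delta> in \<open>simp_all add: left_diff_distrib\<close>)
  finally have "reiter_on act S \<delta> T"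
    using reiter_onI[of T f' act S \<delta>] T(1) f0 by (simp add: f'_def)
  then show ?thesis using T(2) by blast
qed

text \<open>Take \<open>\<phi>\<close> to be the square root of a Reiter function \<open>f\<close>. The inner product of \<open>\<phi>\<close> with its translate is
  at least \<open>\<Sum>x. min (f x) (f (s x))\<close>, because the minimum of two numbers is at most their geometric mean,
  and \<open>min (f x) (f (s x)) = f x - max 0 (f x - f (s x))\<close> brings in the loss. The pointwise inequality
  \<open>2 a b - b^2 \<le> a^2\<close> then bounds the energy of the average from below.\<close>

lemma l2_energy_average_ge_if_reiter_on:
  assumes S: "finite S" "S \<noteq> {}" and bij: "\<And>s. s \<in> S \<Longrightarrow> bij_betw (act s) X X"
    and T: "T \<subseteq> X" "reiter_on act S \<delta> T" and \<delta>: "0 < \<delta>"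
  obtains \<phi> where "\<phi> \<in> l2_space X" "0 < l2_energy X \<phi>"
    "(1 - 2 * \<delta>) * l2_energy X \<phi> \<le> l2_energy X (\<lambda>x. 1 / of_nat (card S) * (\<Sum>s\<in>S. \<phi> (act s x)))"
proof -
  obtain f where fin: "finite T" and f: "\<And>x. 0 \<le> f x" "\<And>x. x \<notin> T \<Longrightarrow> f x = 0"
    "loss act S T f < \<delta> * sum f T"
    using T(2) unfolding reiter_on_def by auto
  define n where "n = real (card S)"
  have n: "1 \<le> n" using S by (simp add: n_def card_gt_0_iff Suc_le_eq)
  define \<phi> where "\<phi> x = complex_of_real (sqrt (f x))" for x
  have sq: "(cmod (\<phi> x))\<^sup>2 = f x" for x using f by (simp add: \<phi>_def)
  have f_int: "integrable (count_space X) f" "(LINT x|count_space X. f x) = sum f T"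
  proof -
    have supp: "{x \<in> X. f x \<noteq> 0} \<subseteq> T" using f by auto
    then have "finite {x \<in> X. f x \<noteq> 0}" using fin finite_subset by blast
    then have *: "Infinite_Set_Sum.abs_summable_on f X"
      by (subst abs_summable_on_cong_neutral[where B = "{x \<in> X. f x \<noteq> 0}" and g = f]) auto
    then show "integrable (count_space X) f" by (simp add: Infinite_Set_Sum.abs_summable_on_def)
    show "(LINT x|count_space X. f x) = sum f T"
      unfolding lebesgue_integral_count_space_finite_support[OF \<open>finite {x \<in> X. f x \<noteq> 0}\<close>]
      by (rule sum.mono_neutral_left[OF fin supp]) (use T(1) in auto)
  qed
  define N where "N = sum f T"
  have \<phi>: "\<phi> \<in> l2_space X" "l2_energy X \<phi> = N"
    using f_int by (simp_all add: l2_space_def l2_energy_def sq N_def)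
  have "0 < \<delta> * N" using f(3) loss_nonneg[of act S T f] unfolding N_def by linarith
  then have N: "0 < N" using \<delta> by (rule zero_less_mult_pos)
  define A where "A x = 1 / of_nat (card S) * (\<Sum>s\<in>S. \<phi> (act s x))" for x
  have A: "A \<in> l2_space X" unfolding A_def by (rule l2_energy_average(1)[OF S bij \<phi>(1)])
  have pointwise: "f x - 2 / n * (\<Sum>s\<in>S. max 0 (f x - f (act s x))) \<le> (cmod (A x))\<^sup>2" for x
  proof -
    define m where "m = (\<Sum>s\<in>S. sqrt (f (act s x))) / n"
    have m: "A x = complex_of_real m" by (simp add: A_def \<phi>_def m_def n_def)
    have "f x - max 0 (f x - f (act s x)) \<le> sqrt (f (act s x)) * sqrt (f x)" for s
    proof -
      have "f x - max 0 (f x - f (act s x)) = sqrt (min (f x) (f (act s x))) * sqrt (min (f x) (f (act s x)))"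
        using f(1) by (simp add: min_def max_def)
      also have "\<dots> \<le> sqrt (f (act s x)) * sqrt (f x)"
        using f(1) by (intro mult_mono) auto
      finally show ?thesis .
    qed
    then have "(\<Sum>s\<in>S. f x - max 0 (f x - f (act s x))) \<le> (\<Sum>s\<in>S. sqrt (f (act s x)) * sqrt (f x))"
      by (rule sum_mono)
    then have "n * f x - (\<Sum>s\<in>S. max 0 (f x - f (act s x))) \<le> n * (m * sqrt (f x))"
      using n by (simp add: sum_subtractf m_def sum_distrib_right[symmetric] n_def)
    then have "f x - (\<Sum>s\<in>S. max 0 (f x - f (act s x))) / n \<le> m * sqrt (f x)"
      using n by (simp add: field_simps)
    moreover have "2 * (m * sqrt (f x)) - f x \<le> m\<^sup>2"
      using zero_le_power2[of "m - sqrt (f x)"] f(1) by (simp add: power2_diff)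
    ultimately show ?thesis unfolding m by simp
  qed
  have "(1 - 2 * \<delta>) * N \<le> N - 2 / n * loss act S T f"
  proof -
    have "loss act S T f / n \<le> loss act S T f"
      using mult_right_mono[OF n loss_nonneg[of act S T f]] n
      by (simp add: divide_le_eq mult.commute)
    then have "2 / n * loss act S T f \<le> 2 * (\<delta> * N)" using f(3) unfolding N_def by simp
    then show ?thesis by (simp add: left_diff_distrib)
  qed
  also have "\<dots> = (\<Sum>x\<in>T. f x - 2 / n * (\<Sum>s\<in>S. max 0 (f x - f (act s x))))"
    unfolding loss_def N_def by (subst sum.swap) (simp add: sum_subtractf sum_distrib_left)
  also have "\<dots> \<le> (\<Sum>x\<in>T. (cmod (A x))\<^sup>2)"
    by (rule sum_mono) (rule pointwise)
  also have "\<dots> \<le> l2_energy X A"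
    unfolding l2_energy_def
    by (rule sum_le_integral_count_space) (use A fin T(1) in \<open>auto simp: l2_space_def\<close>)
  finally show thesis
    using that[of \<phi>] \<phi> N unfolding A_def by simp
qed

context group
begin

lemma bij_betw_l_coset_of_subset:
  assumes "subgroup H G" "S \<subseteq> carrier G" "s \<in> S"
  shows "bij_betw (l_coset G s) (lcosets H) (lcosets H)"
  using bij_betw_l_coset_lcosets[OF assms(1) subsetD[OF assms(2,3)]] .

lemma l2_energy_averaging_op:
  assumes H: "subgroup H G" and S: "finite S" "S \<noteq> {}" "S \<subseteq> carrier G"
    and \<phi>: "\<phi> \<in> l2_space (lcosets H)"
  shows "l2_energy (lcosets H) (averaging_op G S \<phi>) = l2_energy (lcosets H) \<phi>
    - (\<Sum>s\<in>S. \<Sum>t\<in>S. l2_energy (lcosets H) (\<lambda>C. \<phi> (s <# C) - \<phi> (t <# C))) / (2 * (card S)\<^sup>2)"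
  using l2_energy_average(2)[OF S(1,2) bij_betw_l_coset_of_subset[OF H S(3)] \<phi>]
  by (simp add: averaging_op_def[abs_def])

lemma averaging_ratio_le_1:
  assumes H: "subgroup H G" and S: "finite_symmetric_subset G S" and \<phi>: "\<phi> \<in> l2_space (lcosets H)"
  shows "l2_norm (lcosets H) (averaging_op G S \<phi>) / l2_norm (lcosets H) \<phi> \<le> 1"
proof -
  have S': "finite S" "S \<noteq> {}" "S \<subseteq> carrier G" using S by (auto simp: finite_symmetric_subset_def)
  have "l2_energy (lcosets H) (averaging_op G S \<phi>) \<le> l2_energy (lcosets H) \<phi>"
    unfolding l2_energy_averaging_op[OF H S' \<phi>]
    by (auto intro!: divide_nonneg_nonneg sum_nonneg l2_energy_nonneg)
  then have "l2_norm (lcosets H) (averaging_op G S \<phi>) \<le> l2_norm (lcosets H) \<phi>"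
    by (simp add: l2_norm_eq)
  moreover have "0 \<le> l2_norm (lcosets H) \<phi>"
    by (simp add: l2_norm_eq l2_energy_nonneg)
  ultimately show ?thesis
    by (cases "l2_norm (lcosets H) \<phi> = 0") simp_all
qed

lemma cospectral_radius_bounds:
  assumes H: "subgroup H G" and S: "finite_symmetric_subset G S"
  shows "cospectral_radius G S H \<le> 1"
    and "\<phi> \<in> l2_space (lcosets H) \<Longrightarrow>
      l2_norm (lcosets H) (averaging_op G S \<phi>) / l2_norm (lcosets H) \<phi> \<le> cospectral_radius G S H"
    and "r < cospectral_radius G S H \<Longrightarrow> \<exists>\<phi>\<in>l2_space (lcosets H).
      r < l2_norm (lcosets H) (averaging_op G S \<phi>) / l2_norm (lcosets H) \<phi>"
proof -
  let ?q = "\<lambda>\<phi>. l2_norm (lcosets H) (averaging_op G S \<phi>) / l2_norm (lcosets H) \<phi>"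
  have ne: "l2_space (lcosets H) \<noteq> {}"
    by (auto simp: l2_space_def intro!: exI[of _ "\<lambda>_. 0"])
  have bdd: "bdd_above (?q ` l2_space (lcosets H))"
    using averaging_ratio_le_1[OF H S] by (auto intro!: bdd_aboveI2)
  show "cospectral_radius G S H \<le> 1"
    unfolding cospectral_radius_def l2_onorm_def
    by (rule cSUP_least[OF ne]) (rule averaging_ratio_le_1[OF H S])
  show "?q \<phi> \<le> cospectral_radius G S H" if "\<phi> \<in> l2_space (lcosets H)"
    unfolding cospectral_radius_def l2_onorm_def by (rule cSUP_upper[OF that bdd])
  show "\<exists>\<phi>\<in>l2_space (lcosets H). r < ?q \<phi>" if "r < cospectral_radius G S H"
    using that less_cSUP_iff[OF ne bdd] unfolding cospectral_radius_def l2_onorm_def by blast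
qed

text \<open>Enlarge \<open>S\<close> to a symmetric set \<open>P\<close> that contains the identity. If \<open>\<phi>\<close> nearly attains the norm of the
  averaging operator of \<open>P\<close>, then all its translates by elements of \<open>P\<close> are close to each other, and
  \<open>\<phi>\<close> is one of these translates.\<close>

lemma reiter_if_coamenable:
  assumes co: "coamenable G H" and S: "finite S" "S \<subseteq> carrier G" and \<delta>: "0 < \<delta>"
  shows "reiter G S \<delta> H"
proof -
  have H: "subgroup H G" using co by (simp add: coamenable_def)
  define P where "P = insert \<one> (S \<union> m_inv G ` S)"
  have PG: "P \<subseteq> carrier G" "finite P" "P \<noteq> {}" using S by (auto simp: P_def)
  have P: "finite_symmetric_subset G P"
    using PG S unfolding finite_symmetric_subset_def by (auto simp: P_def subset_eq)
  define n where "n = real (card P)"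
  have n: "0 < n" using PG by (simp add: n_def card_gt_0_iff)
  define \<kappa> where "\<kappa> = \<delta> / (3 * card S + \<delta> + 1)"
  have \<kappa>: "0 < \<kappa>" using \<delta> by (simp add: \<kappa>_def)
  define \<eta> where "\<eta> = \<kappa>\<^sup>2 / (2 * n\<^sup>2)"
  have \<eta>: "0 < \<eta>" using \<kappa> n by (simp add: \<eta>_def)
  let ?X = "lcosets H"
  have "sqrt (max 0 (1 - \<eta>)) < 1" using \<eta> by (simp add: max_def)
  also have "1 = cospectral_radius G P H" using co P by (simp add: coamenable_def)
  finally obtain \<phi> where \<phi>: "\<phi> \<in> l2_space ?X"
    and ratio: "sqrt (max 0 (1 - \<eta>)) < l2_norm ?X (averaging_op G P \<phi>) / l2_norm ?X \<phi>"
    using cospectral_radius_bounds(3)[OF H P] by blast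
  let ?N = "l2_energy ?X \<phi>"
  have ratio': "max 0 (1 - \<eta>) < l2_energy ?X (averaging_op G P \<phi>) / ?N"
    using ratio by (simp add: l2_norm_eq flip: real_sqrt_divide)
  then have N: "0 < ?N"
    using l2_energy_nonneg[of ?X \<phi>] by (cases "?N = 0") auto
  let ?D = "\<lambda>s t. l2_energy ?X (\<lambda>C. \<phi> (s <# C) - \<phi> (t <# C))"
  have "(1 - \<eta>) * ?N < l2_energy ?X (averaging_op G P \<phi>)"
    using ratio' N by (simp add: field_simps)
  then have "(\<Sum>s\<in>P. \<Sum>t\<in>P. ?D s t) / (2 * n\<^sup>2) < \<eta> * ?N"
    unfolding n_def l2_energy_averaging_op[OF H PG(2,3,1) \<phi>]
    by (simp add: algebra_simps)
  then have sum_D: "(\<Sum>s\<in>P. \<Sum>t\<in>P. ?D s t) < \<kappa>\<^sup>2 * ?N"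
    using n by (simp add: \<eta>_def field_simps)
  have "\<exists>T\<subseteq>?X. reiter_on (l_coset G) S \<delta> T"
  proof (rule reiter_on_if_l2_almost_invariant[OF S(1) bij_betw_l_coset_of_subset[OF H S(2)] \<phi> N \<delta> \<kappa>_def])
    fix s assume s: "s \<in> S"
    have "l2_energy ?X (\<lambda>C. \<phi> C - \<phi> (s <# C)) = ?D \<one> s"
      unfolding l2_energy_def
      by (rule Bochner_Integration.integral_cong)
        (auto simp: lcos_mult_one lcosets_subset_carrier[OF H])
    also have "\<dots> \<le> (\<Sum>t\<in>P. ?D \<one> t)"
      by (rule member_le_sum) (use s PG in \<open>auto simp: P_def l2_energy_nonneg\<close>)
    also have "\<dots> \<le> (\<Sum>s\<in>P. \<Sum>t\<in>P. ?D s t)"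
      by (rule member_le_sum) (use PG in \<open>auto simp: P_def intro!: sum_nonneg l2_energy_nonneg\<close>)
    finally show "l2_energy ?X (\<lambda>C. \<phi> C - \<phi> (s <# C)) \<le> \<kappa>\<^sup>2 * ?N" using sum_D by simp
  qed
  then show ?thesis by (simp add: reiter_def)
qed

lemma coamenable_if_reiter:
  assumes H: "subgroup H G"
    and reiter: "\<And>S \<delta>. finite S \<Longrightarrow> S \<subseteq> carrier G \<Longrightarrow> 0 < \<delta> \<Longrightarrow> reiter G S \<delta> H"
  shows "coamenable G H"
  unfolding coamenable_def
proof (intro conjI allI impI H)
  fix S assume S: "finite_symmetric_subset G S"
  then have S': "finite S" "S \<noteq> {}" "S \<subseteq> carrier G" by (auto simp: finite_symmetric_subset_def)
  let ?X = "lcosets H" and ?\<rho> = "cospectral_radius G S H"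
  have large: "1 - 2 * \<delta> \<le> ?\<rho>\<^sup>2" if \<delta>: "0 < \<delta>" for \<delta>
  proof -
    obtain T where T: "T \<subseteq> ?X" "reiter_on (l_coset G) S \<delta> T"
      using reiter[OF S'(1,3) \<delta>] by (auto simp: reiter_def)
    obtain \<phi> where \<phi>: "\<phi> \<in> l2_space ?X" "0 < l2_energy ?X \<phi>"
      "(1 - 2 * \<delta>) * l2_energy ?X \<phi> \<le> l2_energy ?X (averaging_op G S \<phi>)"
      using l2_energy_average_ge_if_reiter_on
        [OF S'(1,2) bij_betw_l_coset_of_subset[OF H S'(3)] T \<delta>]
      unfolding averaging_op_def[abs_def] by blast
    have "1 - 2 * \<delta> \<le> l2_energy ?X (averaging_op G S \<phi>) / l2_energy ?X \<phi>"
      using \<phi> by (simp add: field_simps)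
    also have "\<dots> = (l2_norm ?X (averaging_op G S \<phi>) / l2_norm ?X \<phi>)\<^sup>2"
      by (simp add: l2_norm_eq power_divide l2_energy_nonneg)
    also have "\<dots> \<le> ?\<rho>\<^sup>2"
      by (rule power_mono[OF cospectral_radius_bounds(2)[OF H S \<phi>(1)]])
        (simp add: l2_norm_eq l2_energy_nonneg)
    finally show ?thesis .
  qed
  have "0 \<le> ?\<rho>"
    using cospectral_radius_bounds(2)[OF H S, of "\<lambda>_. 0"]
    by (auto simp: l2_space_def l2_norm_def)
  moreover have "1 \<le> ?\<rho>\<^sup>2"
  proof (rule field_le_epsilon)
    fix e :: real assume "0 < e"
    then show "1 \<le> ?\<rho>\<^sup>2 + e" using large[of "e / 2"] by simp
  qed
  ultimately have "1 \<le> ?\<rho>"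
    using power2_le_imp_le[of 1 ?\<rho>] by simp
  then show "?\<rho> = 1" using cospectral_radius_bounds(1)[OF H S] by simp
qed

end

section \<open>Measurability on the space of subgroups\<close>

lemma Sub_borel_sets_open: "openin (Sub_topology G) U \<Longrightarrow> U \<in> sets (Sub_borel G)"
  unfolding Sub_borel_def
  by (subst sets_measure_of) (auto dest: openin_subset)

lemma space_Sub_borel: "space (Sub_borel G) = {H. subgroup H G}"
  unfolding Sub_borel_def topspace_Sub_topology[symmetric]
  by (rule space_measure_of) (auto dest: openin_subset)

lemma sets_Sub_borel_mem:
  assumes "g \<in> carrier G"
  shows "{H \<in> space (Sub_borel G). g \<in> H} \<in> sets (Sub_borel G)"
proof (rule Sub_borel_sets_open)
  let ?P = "product_topology (\<lambda>_. discrete_topology (UNIV :: bool set)) (carrier G)"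
  have "openin ?P {x \<in> topspace ?P. x g \<in> {True}}"
    by (rule openin_continuous_map_preimage[OF continuous_map_product_projection[OF assms]]) simp
  moreover have "{H \<in> space (Sub_borel G). g \<in> H}
      = (\<lambda>H. \<lambda>g\<in>carrier G. g \<in> H) -` {x \<in> topspace ?P. x g \<in> {True}} \<inter> {H. subgroup H G}"
    using assms by (auto simp: space_Sub_borel)
  ultimately show "openin (Sub_topology G) {H \<in> space (Sub_borel G). g \<in> H}"
    unfolding Sub_topology_def openin_pullback_topology by blast
qed

context group
begin

text \<open>On indicator functions, conjugation by \<open>g\<close> is a permutation of the coordinates. So it is continuous.\<close>

lemma measurable_conj_subgroup:
  assumes g: "g \<in> carrier G"
  shows "conj_subgroup G g \<in> measurable (Sub_borel G) (Sub_borel G)"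
proof -
  have "conj_subgroup G g \<in> measurable (Sub_borel G)
    (sigma (topspace (Sub_topology G)) {U. openin (Sub_topology G) U})"
  proof (rule measurable_measure_of)
    let ?P = "product_topology (\<lambda>_. discrete_topology (UNIV :: bool set)) (carrier G)"
    let ?ind = "\<lambda>H. \<lambda>h\<in>carrier G. h \<in> H"
    define c where "c x = (\<lambda>h\<in>carrier G. x (inv g \<otimes> h \<otimes> g))" for x :: "'a \<Rightarrow> bool"
    show "{U. openin (Sub_topology G) U} \<subseteq> Pow (topspace (Sub_topology G))"
      by (auto dest: openin_subset)
    show "conj_subgroup G g \<in> space (Sub_borel G) \<rightarrow> topspace (Sub_topology G)"
      unfolding space_Sub_borel topspace_Sub_topology
      using subgroup_conj_subgroup[OF g] by blast
    have c: "continuous_map ?P ?P c"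
      unfolding continuous_map_componentwise
    proof (intro conjI ballI)
      show "c ` topspace ?P \<subseteq> extensional (carrier G)"
        by (auto simp: c_def)
      fix h assume h: "h \<in> carrier G"
      then have "(\<lambda>x. c x h) = (\<lambda>x. x (inv g \<otimes> h \<otimes> g))" by (simp add: c_def)
      then show "continuous_map ?P (discrete_topology UNIV) (\<lambda>x. c x h)"
        using continuous_map_product_projection[of "inv g \<otimes> h \<otimes> g" "carrier G" "\<lambda>_. discrete_topology UNIV"] g h
        by simp
    qed
    have c_ind: "c (?ind H) = ?ind (conj_subgroup G g H)" if "subgroup H G" for H
      using g mem_conj_subgroup_iff[OF g _ subgroup.subset[OF that]]
      by (auto simp: c_def fun_eq_iff restrict_def)
    fix U assume "U \<in> {U. openin (Sub_topology G) U}"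
    then obtain V where V: "openin ?P V" "U = ?ind -` V \<inter> {H. subgroup H G}"
      unfolding Sub_topology_def openin_pullback_topology by blast
    have "conj_subgroup G g -` U \<inter> {H. subgroup H G}
        = ?ind -` {x \<in> topspace ?P. c x \<in> V} \<inter> {H. subgroup H G}"
    proof -
      have "conj_subgroup G g H \<in> U \<longleftrightarrow> ?ind H \<in> {x \<in> topspace ?P. c x \<in> V}" if "subgroup H G" for H
        using c_ind[OF that] subgroup_conj_subgroup[OF g that] V(2) by simp
      then show ?thesis by blast
    qed
    moreover have "openin ?P {x \<in> topspace ?P. c x \<in> V}"
      by (rule openin_continuous_map_preimage[OF c V(1)])
    ultimately have "openin (Sub_topology G) (conj_subgroup G g -` U \<inter> {H. subgroup H G})"
      unfolding Sub_topology_def openin_pullback_topology by blast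
    then show "conj_subgroup G g -` U \<inter> space (Sub_borel G) \<in> sets (Sub_borel G)"
      unfolding space_Sub_borel by (rule Sub_borel_sets_open)
  qed
  then show ?thesis unfolding Sub_borel_def .
qed

text \<open>The event is a finite union of events that prescribe \<open>Z \<omega> \<inter> W\<close> for a finite set \<open>W\<close>.\<close>

lemma sets_reiter_on_cosets:
  assumes Z: "\<And>\<omega>. \<omega> \<in> space N \<Longrightarrow> subgroup (Z \<omega>) G"
    and Z_meas: "\<And>g. g \<in> carrier G \<Longrightarrow> {\<omega> \<in> space N. g \<in> Z \<omega>} \<in> sets N"
    and S: "finite S" "S \<subseteq> carrier G" and T: "finite T" "T \<subseteq> carrier G"
  shows "{\<omega> \<in> space N. reiter_on (l_coset G) S \<delta> ((\<lambda>g. g <# Z \<omega>) ` T)} \<in> sets N"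
proof -
  define W where "W = (\<lambda>(g, g'). inv g \<otimes> g') ` (T \<times> T)
    \<union> (\<lambda>(s, g, g'). inv (s \<otimes> g) \<otimes> g') ` (S \<times> T \<times> T)"
  have W: "finite W" using S T by (simp add: W_def)
  have WG: "w \<in> carrier G" if "w \<in> W" for w
    using that S(2) T(2) by (auto simp: W_def subset_eq)
  define P where "P \<omega> \<longleftrightarrow> reiter_on (l_coset G) S \<delta> ((\<lambda>g. g <# Z \<omega>) ` T)" for \<omega>
  have P_cong: "P \<omega>'" if "\<omega> \<in> space N" "\<omega>' \<in> space N" "Z \<omega> \<inter> W = Z \<omega>' \<inter> W" "P \<omega>" for \<omega> \<omega>'
    unfolding P_def
  proof (rule reiter_on_cosets_cong[OF Z[OF that(1)] Z[OF that(2)] S(2) T(2)])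
    show "reiter_on (l_coset G) S \<delta> ((\<lambda>g. g <# Z \<omega>) ` T)" using that(4) by (simp add: P_def)
    have W_iff: "w \<in> Z \<omega> \<longleftrightarrow> w \<in> Z \<omega>'" if "w \<in> W" for w
      using \<open>Z \<omega> \<inter> W = Z \<omega>' \<inter> W\<close> that by blast
    show "inv g \<otimes> g' \<in> Z \<omega> \<longleftrightarrow> inv g \<otimes> g' \<in> Z \<omega>'" if "g \<in> T" "g' \<in> T" for g g'
      by (rule W_iff) (use that in \<open>force simp: W_def\<close>)
    show "inv (s \<otimes> g) \<otimes> g' \<in> Z \<omega> \<longleftrightarrow> inv (s \<otimes> g) \<otimes> g' \<in> Z \<omega>'"
      if "s \<in> S" "g \<in> T" "g' \<in> T" for s g g'
      by (rule W_iff) (use that in \<open>force simp: W_def\<close>)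
  qed
  define \<A> where "\<A> = (\<lambda>\<omega>. Z \<omega> \<inter> W) ` {\<omega> \<in> space N. P \<omega>}"
  have \<A>: "finite \<A>" by (rule finite_subset[of _ "Pow W"]) (use W in \<open>auto simp: \<A>_def\<close>)
  have "{\<omega> \<in> space N. P \<omega>} = {\<omega> \<in> space N. \<exists>A\<in>\<A>. \<forall>w\<in>W. w \<in> Z \<omega> \<longleftrightarrow> w \<in> A}"
  proof (intro Collect_cong conj_cong refl iffI)
    fix \<omega> assume "\<omega> \<in> space N" "P \<omega>"
    then show "\<exists>A\<in>\<A>. \<forall>w\<in>W. w \<in> Z \<omega> \<longleftrightarrow> w \<in> A"
      by (intro bexI[of _ "Z \<omega> \<inter> W"]) (auto simp: \<A>_def)
  next
    fix \<omega> assume \<omega>: "\<omega> \<in> space N" and "\<exists>A\<in>\<A>. \<forall>w\<in>W. w \<in> Z \<omega> \<longleftrightarrow> w \<in> A"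
    then obtain \<omega>' where \<omega>': "\<omega>' \<in> space N" "P \<omega>'" "\<forall>w\<in>W. w \<in> Z \<omega> \<longleftrightarrow> w \<in> Z \<omega>' \<inter> W"
      unfolding \<A>_def by blast
    then have "Z \<omega>' \<inter> W = Z \<omega> \<inter> W" by blast
    then show "P \<omega>" using P_cong \<omega> \<omega>' by blast
  qed
  also have "\<dots> \<in> sets N"
  proof (intro sets.sets_Collect_finite_Ex[OF _ \<A>] sets.sets_Collect_finite_All[OF _ W])
    fix A w assume "w \<in> W"
    then show "{\<omega> \<in> space N. w \<in> Z \<omega> \<longleftrightarrow> w \<in> A} \<in> sets N"
      using Z_meas[OF WG, of w] by (cases "w \<in> A") (simp_all add: sets.sets_Collect_neg)
  qed
  finally show ?thesis unfolding P_def .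
qed

lemma sets_reiter:
  assumes count: "countable (carrier G)"
    and Z: "\<And>\<omega>. \<omega> \<in> space N \<Longrightarrow> subgroup (Z \<omega>) G"
    and Z_meas: "\<And>g. g \<in> carrier G \<Longrightarrow> {\<omega> \<in> space N. g \<in> Z \<omega>} \<in> sets N"
    and S: "finite S" "S \<subseteq> carrier G"
  shows "{\<omega> \<in> space N. reiter G S \<delta> (Z \<omega>)} \<in> sets N"
proof -
  let ?F = "{T. finite T \<and> T \<subseteq> carrier G}"
  have "{\<omega> \<in> space N. reiter G S \<delta> (Z \<omega>)}
      = {\<omega> \<in> space N. \<exists>T\<in>?F. reiter_on (l_coset G) S \<delta> ((\<lambda>g. g <# Z \<omega>) ` T)}"
    by (intro Collect_cong conj_cong refl) (simp add: reiter_iff_finite_representatives[OF Z] conj_assoc)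
  also have "\<dots> \<in> sets N"
    by (rule sets.sets_Collect_countable_Ex')
      (use sets_reiter_on_cosets[OF Z Z_meas S] countable_Collect_finite_subset[OF count] in auto)
  finally show ?thesis .
qed

section \<open>Intersections with a random subgroup\<close>

text \<open>One fixed subgroup and one random one, following the contradiction described at the beginning. Here \<open>p\<close> is the
  probability that \<open>H \<inter> K\<close> has no Reiter function for \<open>S\<close> and \<open>\<delta>\<close>, and \<open>m K\<close> is the bad \<open>u\<close>-mass in the fibre
  over \<open>K\<close>.\<close>

lemma AE_reiter_Int:
  assumes count: "countable (carrier G)" and \<mu>: "prob_space \<mu>" and sets_\<mu>: "sets \<mu> = sets (Sub_borel G)"
    and inv: "\<And>g. g \<in> carrier G \<Longrightarrow> distr \<mu> (Sub_borel G) (conj_subgroup G g) = \<mu>"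
    and \<mu>_reiter: "\<And>S \<delta>. finite S \<Longrightarrow> S \<subseteq> carrier G \<Longrightarrow> 0 < \<delta> \<Longrightarrow> AE K in \<mu>. reiter G S \<delta> K"
    and H: "subgroup H G"
    and H_reiter: "\<And>S \<delta>. finite S \<Longrightarrow> S \<subseteq> carrier G \<Longrightarrow> 0 < \<delta> \<Longrightarrow> reiter G S \<delta> H"
    and S: "finite S" "S \<subseteq> carrier G" and \<delta>: "0 < \<delta>"
  shows "AE K in \<mu>. reiter G S \<delta> (H \<inter> K)"
proof (rule ccontr)
  interpret \<mu>: prob_space \<mu> by fact
  have space_\<mu>: "space \<mu> = {K. subgroup K G}"
    using sets_eq_imp_space_eq[OF sets_\<mu>] by (simp add: space_Sub_borel)
  have mem: "{K \<in> space \<mu>. g \<in> K} \<in> sets \<mu>" if "g \<in> carrier G" for g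
    using sets_Sub_borel_mem[OF that] by (simp add: sets_\<mu> space_\<mu> space_Sub_borel)
  have mem_Int: "{K \<in> space \<mu>. g \<in> H \<inter> K} \<in> sets \<mu>" if "g \<in> carrier G" for g
    using mem[OF that] by (cases "g \<in> H") auto
  define bad where "bad = {K \<in> space \<mu>. \<not> reiter G S \<delta> (H \<inter> K)}"
  have good_sets: "{K \<in> space \<mu>. reiter G S \<delta> (H \<inter> K)} \<in> sets \<mu>"
    by (rule sets_reiter[OF count _ mem_Int S]) (auto simp: space_\<mu> subgroups_Inter_pair[OF H])
  then have bad_sets: "bad \<in> sets \<mu>"
    unfolding bad_def by (rule sets.sets_Collect_neg)
  define p where "p = measure \<mu> bad"
  assume not_AE: "\<not> (AE K in \<mu>. reiter G S \<delta> (H \<inter> K))"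
  have p: "0 < p"
  proof -
    have "p \<noteq> 0"
    proof
      assume "p = 0"
      then have "bad \<in> null_sets \<mu>"
        using bad_sets by (simp add: p_def null_sets_def \<mu>.emeasure_eq_measure)
      then have "AE K in \<mu>. K \<notin> bad" by (rule AE_not_in)
      then have "AE K in \<mu>. reiter G S \<delta> (H \<inter> K)"
        by (rule AE_mp) (auto simp: bad_def)
      then show False using not_AE by contradiction
    qed
    then show ?thesis by (simp add: p_def less_le)
  qed
  \<comment> \<open>The solution of \<open>\<delta> * (p / 2 - \<epsilon>) = 2 * \<epsilon>\<close>: the two sides are the bounds compared at the end.\<close>
  define \<epsilon> where "\<epsilon> = \<delta> * p / (2 * (2 + \<delta>))"
  have \<epsilon>: "0 < \<epsilon>" using p \<delta> by (simp add: \<epsilon>_def)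

  define B where "B T = {K \<in> space \<mu>. reiter_on (l_coset G) S \<epsilon> ((\<lambda>g. g <# K) ` T)}" for T
  have B_sets: "B T \<in> sets \<mu>" if "finite T" "T \<subseteq> carrier G" for T
    unfolding B_def by (rule sets_reiter_on_cosets[OF _ mem S that]) (simp add: space_\<mu>)
  \<comment> \<open>Almost every \<open>K\<close> has a Reiter function; its support has representatives in one of the
    increasing finite sets \<open>R n\<close>, which exhaust the group.\<close>
  obtain T where T: "finite T" "T \<subseteq> carrier G" "1 - p / 2 < measure \<mu> (B T)"
  proof -
    define R where "R n = from_nat_into (carrier G) ` {..n}" for n :: nat
    have R: "finite (R n)" "R n \<subseteq> carrier G" for n
      using from_nat_into[of "carrier G"] one_closed by (auto simp: R_def)
    have "range (\<lambda>n. B (R n)) \<subseteq> sets \<mu>" using B_sets R by blast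
    moreover have "incseq (\<lambda>n. B (R n))"
    proof (rule incseq_SucI)
      fix n
      show "B (R n) \<subseteq> B (R (Suc n))"
      proof
        fix K assume K: "K \<in> B (R n)"
        have "(\<lambda>g. g <# K) ` R n \<subseteq> (\<lambda>g. g <# K) ` R (Suc n)"
          unfolding R_def by (intro image_mono) simp
        then show "K \<in> B (R (Suc n))"
          using K R(1) reiter_on_superset[of "l_coset G" S \<epsilon> _ "(\<lambda>g. g <# K) ` R (Suc n)"]
          unfolding B_def by blast
      qed
    qed
    ultimately have "(\<lambda>n. measure \<mu> (B (R n))) \<longlonglongrightarrow> measure \<mu> (\<Union>n. B (R n))"
      by (rule \<mu>.finite_Lim_measure_incseq)
    moreover have "measure \<mu> (\<Union>n. B (R n)) = 1"
    proof -
      have "AE K in \<mu>. K \<in> (\<Union>n. B (R n))"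
        using \<mu>_reiter[OF S \<epsilon>] AE_space
      proof eventually_elim
        case (elim K)
        then have K: "subgroup K G" by (simp add: space_\<mu>)
        obtain T where T: "finite T" "T \<subseteq> carrier G" "reiter_on (l_coset G) S \<epsilon> ((\<lambda>g. g <# K) ` T)"
          using elim(1) unfolding reiter_iff_finite_representatives[OF K] by blast
        obtain n where n: "T \<subseteq> R n"
        proof -
          have "T \<subseteq> from_nat_into (carrier G) ` UNIV"
            using T(2) range_from_nat_into[OF carrier_not_empty count] by simp
          then obtain I where I: "finite I" "T = from_nat_into (carrier G) ` I"
            using finite_subset_image[OF T(1)] by metis
          have "I \<subseteq> {..Max (insert 0 I)}" using I(1) by auto
          then have "T \<subseteq> R (Max (insert 0 I))" unfolding I(2) R_def by blast
          then show thesis by (rule that)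
        qed
        have "reiter_on (l_coset G) S \<epsilon> ((\<lambda>g. g <# K) ` R n)"
          by (rule reiter_on_superset[OF T(3) image_mono[OF n] finite_imageI[OF R(1)]])
        then have "K \<in> B (R n)" using elim(2) unfolding B_def by blast
        then show ?case by blast
      qed
      moreover have "(\<Union>n. B (R n)) \<in> sets \<mu>"
        by (intro sets.countable_UN'' B_sets R) simp
      ultimately show ?thesis by (simp only: \<mu>.prob_eq_1)
    qed
    ultimately have "(\<lambda>n. measure \<mu> (B (R n))) \<longlonglongrightarrow> 1" by simp
    moreover have "1 - p / 2 < 1" using p by simp
    ultimately have "eventually (\<lambda>n. 1 - p / 2 < measure \<mu> (B (R n))) sequentially"
      by (rule order_tendstoD(1))
    then obtain n where "1 - p / 2 < measure \<mu> (B (R n))"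
      unfolding eventually_sequentially by blast
    then show thesis by (rule that[OF R])
  qed

  \<comment> \<open>\<open>T\<close> is already fixed, so \<open>u\<close> can be chosen almost invariant under \<open>T\<close>, too.\<close>
  obtain U u where U: "finite U" "U \<subseteq> lcosets H"
    and u: "\<And>C. 0 \<le> u C" "\<And>C. C \<notin> U \<Longrightarrow> u C = 0" "loss (l_coset G) (S \<union> T) U u < \<epsilon> * sum u U"
  proof -
    have "reiter G (S \<union> T) \<epsilon> H" using H_reiter S T \<epsilon> by simp
    then show thesis using that unfolding reiter_def reiter_on_def by blast
  qed
  have loss_S: "loss (l_coset G) S U u < \<epsilon> * sum u U"
    using loss_mono_elements[of "S \<union> T" S "l_coset G" U u] u(3) S T by simp
  have loss_T: "loss (l_coset G) T U u < \<epsilon> * sum u U"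
    using loss_mono_elements[of "S \<union> T" T "l_coset G" U u] u(3) S T by simp
  have u_pos: "0 < sum u U"
  proof -
    have "0 < \<epsilon> * sum u U" using loss_nonneg[of "l_coset G" S U u] loss_S by linarith
    then show ?thesis using \<epsilon> by (rule zero_less_mult_pos)
  qed
  define rep where "rep C = (SOME g. g \<in> carrier G \<and> C = g <# H)" for C
  have rep: "rep C \<in> carrier G" "C = rep C <# H" if "C \<in> U" for C
  proof -
    have "\<exists>g. g \<in> carrier G \<and> C = g <# H" using U(2) that by (auto simp: LCOSETS_def)
    then have "rep C \<in> carrier G \<and> C = rep C <# H" unfolding rep_def by (rule someI_ex)
    then show "rep C \<in> carrier G" "C = rep C <# H" by blast+
  qed
  \<comment> \<open>For fixed \<open>C = gH\<close>, the event that \<open>(C, K)\<close> is bad is the preimage of \<open>bad\<close> under conjugation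
    by the inverse of \<open>g\<close>, so invariance gives it probability \<open>p\<close>.\<close>
  define A where "A C = conj_subgroup G (inv (rep C)) -` bad \<inter> space \<mu>" for C
  have conj_meas: "conj_subgroup G g \<in> measurable \<mu> (Sub_borel G)" if "g \<in> carrier G" for g
    using measurable_conj_subgroup[OF that] measurable_cong_sets[OF sets_\<mu> refl] by blast
  have A: "A C \<in> sets \<mu>" "measure \<mu> (A C) = p" if "C \<in> U" for C
  proof -
    have g: "inv (rep C) \<in> carrier G" using rep(1)[OF that] by simp
    show "A C \<in> sets \<mu>"
      unfolding A_def by (rule measurable_sets[OF conj_meas[OF g]]) (use bad_sets sets_\<mu> in simp)
    have "p = measure (distr \<mu> (Sub_borel G) (conj_subgroup G (inv (rep C)))) bad"
      unfolding p_def inv[OF g] ..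
    also have "\<dots> = measure \<mu> (A C)"
      unfolding A_def by (rule measure_distr[OF conj_meas[OF g]]) (use bad_sets sets_\<mu> in simp)
    finally show "measure \<mu> (A C) = p" ..
  qed
  define m where "m K = (\<Sum>C\<in>U. u C * indicator (A C) K)" for K :: "'a set"
  have m_int: "integrable \<mu> m" "(LINT K|\<mu>. m K) = p * sum u U"
  proof -
    have int: "integrable \<mu> (\<lambda>K. u C * indicator (A C) K)" if "C \<in> U" for C
      using A(1)[OF that] by (intro integrable_mult_right) (simp add: \<mu>.emeasure_eq_measure)
    then show "integrable \<mu> m" unfolding m_def by (rule Bochner_Integration.integrable_sum)
    have "(LINT K|\<mu>. m K) = (\<Sum>C\<in>U. LINT K|\<mu>. u C * indicator (A C) K)"
      unfolding m_def by (rule Bochner_Integration.integral_sum[OF int])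
    also have "\<dots> = (\<Sum>C\<in>U. u C * p)"
    proof (rule sum.cong[OF refl])
      fix C assume C: "C \<in> U"
      then have "A C \<inter> space \<mu> = A C" by (auto simp: A_def)
      then show "(LINT K|\<mu>. u C * indicator (A C) K) = u C * p"
        using A(2)[OF C] by simp
    qed
    finally show "(LINT K|\<mu>. m K) = p * sum u U" by (simp add: sum_distrib_left mult.commute)
  qed
  have m_le: "m K \<le> sum u U" for K
    unfolding m_def by (rule sum_mono) (use u(1) in \<open>auto simp: indicator_def\<close>)
  \<comment> \<open>Otherwise \<open>m\<close> would be below \<open>p / 2 * sum u U\<close> on \<open>B T\<close> and at most \<open>sum u U\<close> on the complement,
    whose probability is less than \<open>p / 2\<close>; but the mean of \<open>m\<close> is \<open>p * sum u U\<close>.\<close>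
  have "\<exists>K\<in>B T. p / 2 * sum u U \<le> m K"
  proof (rule ccontr)
    assume none: "\<not> (\<exists>K\<in>B T. p / 2 * sum u U \<le> m K)"
    have "m K \<le> p / 2 * sum u U + sum u U * indicator (space \<mu> - B T) K" if "K \<in> space \<mu>" for K
    proof (cases "K \<in> B T")
      case True
      then have "m K < p / 2 * sum u U" using none not_le by blast
      then show ?thesis using True by simp
    next
      case False
      then show ?thesis using m_le[of K] that p u_pos by (simp add: add_increasing)
    qed
    moreover have BT: "space \<mu> - B T \<in> sets \<mu>" using B_sets T by blast
    moreover have int: "integrable \<mu> (\<lambda>K. sum u U * indicator (space \<mu> - B T) K)"
      using BT by (intro integrable_mult_right) (simp add: \<mu>.emeasure_eq_measure)
    ultimately have "(LINT K|\<mu>. m K)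
        \<le> (LINT K|\<mu>. p / 2 * sum u U + sum u U * indicator (space \<mu> - B T) K)"
      using m_int(1) by (intro integral_mono) auto
    also have "\<dots> = p / 2 * sum u U + sum u U * measure \<mu> (space \<mu> - B T)"
      using int by (subst Bochner_Integration.integral_add) (simp_all add: \<mu>.prob_space Int_absorb2)
    also have "measure \<mu> (space \<mu> - B T) = 1 - measure \<mu> (B T)"
      by (rule \<mu>.prob_compl) (use B_sets T in blast)
    also have "p / 2 * sum u U + sum u U * (1 - measure \<mu> (B T)) < p / 2 * sum u U + sum u U * (p / 2)"
      by (intro add_strict_left_mono mult_strict_left_mono u_pos) (use T(3) in linarith)
    finally show False unfolding m_int(2) by (simp add: algebra_simps)
  qed
  then obtain K where K: "K \<in> B T" "p / 2 * sum u U \<le> m K" by blast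
  then have K_sub: "subgroup K G" and K_sp: "K \<in> space \<mu>" by (auto simp: B_def space_\<mu>)
  define V where "V = (\<lambda>g. g <# K) ` T"
  obtain v where v: "\<And>D. 0 \<le> v D" "\<And>D. D \<notin> V \<Longrightarrow> v D = 0"
    "loss (l_coset G) S V v < \<epsilon> * sum v V"
    using K(1) unfolding B_def V_def reiter_on_def by blast
  have v_pos: "0 < sum v V"
  proof -
    have "0 < \<epsilon> * sum v V" using loss_nonneg[of "l_coset G" S V v] v(3) by linarith
    then show ?thesis using \<epsilon> by (rule zero_less_mult_pos)
  qed
  have m_K: "m K = (\<Sum>C | C \<in> U \<and> \<not> reiter G S \<delta> (H \<inter> conj_subgroup G (inv (rep C)) K). u C)"
  proof -
    have "K \<in> A C \<longleftrightarrow> \<not> reiter G S \<delta> (H \<inter> conj_subgroup G (inv (rep C)) K)" if "C \<in> U" for C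
      using K_sp subgroup_conj_subgroup[OF inv_closed[OF rep(1)[OF that]] K_sub]
      by (simp add: A_def bad_def space_\<mu>)
    then have "m K = (\<Sum>C\<in>U. if \<not> reiter G S \<delta> (H \<inter> conj_subgroup G (inv (rep C)) K) then u C else 0)"
      unfolding m_def by (intro sum.cong) (auto simp: indicator_def)
    then show ?thesis by (simp add: sum.inter_filter[OF U(1)])
  qed
  have "\<delta> * ((p / 2 * sum u U - \<epsilon> * sum u U) * sum v V)
      \<le> \<delta> * ((m K - loss (l_coset G) T U u) * sum v V)"
    using K(2) loss_T \<delta> v_pos by (intro mult_left_mono mult_right_mono) auto
  also have "\<dots> \<le> loss (l_coset G) S U u * sum v V + sum u U * loss (l_coset G) S V v"
    unfolding m_K V_def
    by (rule non_reiter_mass_bound[OF H K_sub S(2) T(1,2) U rep u(1,2) v(1) v(2)[unfolded V_def]])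
      (use \<delta> in auto)
  also have "\<dots> < (\<epsilon> * sum u U) * sum v V + sum u U * (\<epsilon> * sum v V)"
    using loss_S v(3) u_pos v_pos by (intro add_strict_mono mult_strict_right_mono mult_strict_left_mono)
  finally have "(\<delta> * (p / 2 - \<epsilon>)) * (sum u U * sum v V) < (2 * \<epsilon>) * (sum u U * sum v V)"
    by (simp add: algebra_simps)
  then have "\<delta> * (p / 2 - \<epsilon>) < 2 * \<epsilon>"
    by (rule mult_right_less_imp_less) (use u_pos v_pos in simp)
  moreover have "\<delta> * (p / 2 - \<epsilon>) = 2 * \<epsilon>"
  proof -
    have "\<epsilon> * (2 * (2 + \<delta>)) = \<delta> * p" using \<delta> by (simp add: \<epsilon>_def)
    then show ?thesis by (simp add: algebra_simps)
  qed
  ultimately show False by simp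
qed

end

text \<open>In a countable group there are only countably many \<open>S\<close>, and it suffices to consider \<open>\<delta> = 1 / Suc n\<close>.\<close>

lemma AE_all_reiter:
  assumes count: "countable (carrier G)"
    and AE: "\<And>S \<delta>. finite S \<Longrightarrow> S \<subseteq> carrier G \<Longrightarrow> 0 < \<delta> \<Longrightarrow> AE \<omega> in N. reiter G S \<delta> (Z \<omega>)"
  shows "AE \<omega> in N. \<forall>S \<delta>. finite S \<longrightarrow> S \<subseteq> carrier G \<longrightarrow> 0 < \<delta> \<longrightarrow> reiter G S \<delta> (Z \<omega>)"
proof -
  have "AE \<omega> in N. \<forall>S\<in>{S. finite S \<and> S \<subseteq> carrier G}. \<forall>n. reiter G S (1 / real (Suc n)) (Z \<omega>)"
    unfolding AE_ball_countable[OF countable_Collect_finite_subset[OF count]] AE_all_countable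
    using AE by simp
  then show ?thesis
  proof eventually_elim
    case (elim \<omega>)
    show ?case
    proof (intro allI impI)
      fix S and \<delta> :: real assume S: "finite S" "S \<subseteq> carrier G" and \<delta>: "0 < \<delta>"
      obtain n where n: "1 / real (Suc n) < \<delta>"
        by (rule nat_approx_posE[OF \<delta>])
      have "reiter G S (1 / real (Suc n)) (Z \<omega>)" using elim S by blast
      then show "reiter G S \<delta> (Z \<omega>)" by (rule reiter_mono[OF _ less_imp_le[OF n]])
    qed
  qed
qed

theorem corollary1p3:
  fixes G :: "('a, 'm) monoid_scheme"
    and M :: "'w measure"
    and H1 H2 :: "'w \<Rightarrow> 'a set"
  assumes "group G"
    and "countable (carrier G)"
    and "prob_space M"
    and "coamenable_irs G M H1"
    and "coamenable_irs G M H2"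
    and "prob_space.indep_var M (Sub_borel G) H1 (Sub_borel G) H2"
  shows "AE \<omega> in M. coamenable G (H1 \<omega> \<inter> H2 \<omega>)"
proof -
  interpret group G by fact
  interpret M: prob_space M by fact
  note count = assms(2)
  let ?B = "Sub_borel G"
  define \<mu>1 where "\<mu>1 = distr M ?B H1"
  define \<mu>2 where "\<mu>2 = distr M ?B H2"
  have rv: "H1 \<in> measurable M ?B" "H2 \<in> measurable M ?B"
    using assms(4,5) by (auto simp: coamenable_irs_def invariant_random_subgroup_def)
  interpret \<mu>1: prob_space \<mu>1 unfolding \<mu>1_def by (rule M.prob_space_distr[OF rv(1)])
  interpret \<mu>2: prob_space \<mu>2 unfolding \<mu>2_def by (rule M.prob_space_distr[OF rv(2)])
  interpret \<mu>: pair_prob_space \<mu>1 \<mu>2 ..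
  have sets_\<mu>: "sets \<mu>1 = sets ?B" "sets \<mu>2 = sets ?B" by (simp_all add: \<mu>1_def \<mu>2_def)
  have joint: "\<mu>1 \<Otimes>\<^sub>M \<mu>2 = distr M (?B \<Otimes>\<^sub>M ?B) (\<lambda>\<omega>. (H1 \<omega>, H2 \<omega>))"
    using assms(6) unfolding M.indep_var_distribution_eq \<mu>1_def \<mu>2_def by blast
  have reiter_law: "AE K in distr M ?B Z. reiter G S \<delta> K"
    if "coamenable_irs G M Z" "finite S" "S \<subseteq> carrier G" "0 < \<delta>" for Z S \<delta>
  proof -
    have "{K \<in> space ?B. reiter G S \<delta> K} \<in> sets ?B"
      by (rule sets_reiter[OF count _ sets_Sub_borel_mem that(2,3)]) (simp_all add: space_Sub_borel)
    moreover have "Z \<in> measurable M ?B" and "AE \<omega> in M. coamenable G (Z \<omega>)"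
      using that(1) by (auto simp: coamenable_irs_def invariant_random_subgroup_def)
    moreover from this(2) have "AE \<omega> in M. reiter G S \<delta> (Z \<omega>)"
      by eventually_elim (rule reiter_if_coamenable[OF _ that(2-4)])
    ultimately show ?thesis by (simp add: AE_distr_iff)
  qed
  have "AE \<omega> in M. reiter G S \<delta> (H1 \<omega> \<inter> H2 \<omega>)"
    if S: "finite S" "S \<subseteq> carrier G" and \<delta>: "0 < \<delta>" for S \<delta>
  proof -
    let ?R = "{p \<in> space (?B \<Otimes>\<^sub>M ?B). reiter G S \<delta> (fst p \<inter> snd p)}"
    have R: "?R \<in> sets (?B \<Otimes>\<^sub>M ?B)"
    proof (rule sets_reiter[OF count _ _ S])
      show "subgroup (fst p \<inter> snd p) G" if "p \<in> space (?B \<Otimes>\<^sub>M ?B)" for p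
        using that by (auto simp: space_pair_measure space_Sub_borel intro: subgroups_Inter_pair)
      fix g assume g: "g \<in> carrier G"
      have "{p \<in> space (?B \<Otimes>\<^sub>M ?B). g \<in> fst p \<inter> snd p}
          = {H \<in> space ?B. g \<in> H} \<times> {K \<in> space ?B. g \<in> K}"
        by (auto simp: space_pair_measure)
      then show "{p \<in> space (?B \<Otimes>\<^sub>M ?B). g \<in> fst p \<inter> snd p} \<in> sets (?B \<Otimes>\<^sub>M ?B)"
        using sets_Sub_borel_mem[OF g] by simp
    qed
    have "AE H in \<mu>1. \<forall>S \<delta>. finite S \<longrightarrow> S \<subseteq> carrier G \<longrightarrow> 0 < \<delta> \<longrightarrow> reiter G S \<delta> H"
      unfolding \<mu>1_def by (rule AE_all_reiter[OF count]) (rule reiter_law[OF assms(4)])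
    then have "AE H in \<mu>1. AE K in \<mu>2. reiter G S \<delta> (H \<inter> K)"
      using AE_space
    proof eventually_elim
      case (elim H)
      show ?case
      proof (rule AE_reiter_Int[OF count \<mu>2.prob_space_axioms sets_\<mu>(2)])
        show "distr \<mu>2 ?B (conj_subgroup G g) = \<mu>2" if "g \<in> carrier G" for g
          using assms(5) that
          by (simp add: \<mu>2_def coamenable_irs_def invariant_random_subgroup_def)
        show "AE K in \<mu>2. reiter G S' \<delta>' K" if "finite S'" "S' \<subseteq> carrier G" "0 < \<delta>'" for S' \<delta>'
          unfolding \<mu>2_def by (rule reiter_law[OF assms(5) that])
        show "subgroup H G" using elim(2) by (simp add: \<mu>1_def space_Sub_borel)
        show "reiter G S' \<delta>' H" if "finite S'" "S' \<subseteq> carrier G" "0 < \<delta>'" for S' \<delta>'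
          using elim(1) that by blast
      qed (use S \<delta> in auto)
    qed
    moreover have "{p \<in> space (\<mu>1 \<Otimes>\<^sub>M \<mu>2). reiter G S \<delta> (fst p \<inter> snd p)} \<in> sets (\<mu>1 \<Otimes>\<^sub>M \<mu>2)"
      using R unfolding joint by simp
    ultimately have "AE p in \<mu>1 \<Otimes>\<^sub>M \<mu>2. reiter G S \<delta> (fst p \<inter> snd p)"
      by (simp add: \<mu>.AE_pair_measure)
    then show ?thesis
      unfolding joint using R rv by (simp add: AE_distr_iff)
  qed
  then have "AE \<omega> in M. \<forall>S \<delta>. finite S \<longrightarrow> S \<subseteq> carrier G \<longrightarrow> 0 < \<delta> \<longrightarrow>
      reiter G S \<delta> (H1 \<omega> \<inter> H2 \<omega>)"
    by (rule AE_all_reiter[OF count])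
  then show ?thesis
    using AE_space
  proof eventually_elim
    case (elim \<omega>)
    have "H1 \<omega> \<in> space ?B" "H2 \<omega> \<in> space ?B"
      using measurable_space[OF rv(1) elim(2)] measurable_space[OF rv(2) elim(2)] by auto
    then have "subgroup (H1 \<omega> \<inter> H2 \<omega>) G"
      by (auto simp: space_Sub_borel intro: subgroups_Inter_pair)
    then show ?case using elim(1) by (intro coamenable_if_reiter) auto
  qed
qed

end
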